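(* Let $\alpha=\{\alpha_k\}_{k=0}^\infty$ be a sequence of real numbers. The following are equivalent: (i) $U_\alpha(\mathcal{P}^+)\subseteq\mathcal{P}^+\cup\{0\}$; (ii) $U_\alpha(e^z)\in\mathcal{LP}^+\cup\{0\}$, that is, $$\sum_{k=0}^\infty\left(\sum_{j=0}^k\frac{\alpha_j}{(k+j)!(k-j)!}\right)z^k\in\mathcal{LP}^+\cup\{0\};$$ (iii) $U_\alpha(\mathcal{LP}^+)\subseteq\mathcal{LP}^+\cup\{0\}$.
   Context: For a polynomial or power series $\phi(z)=\sum_{k\ge0}a_kz^k$, $U_\alpha(\phi)=\sum_{k\ge0}b_kz^k$ with $b_k=\sum_{j\ge0}\alpha_ja_{k-j}a_{k+j}$, where $a_j=0$ for $j<0$ (and for $j>n$ if $\phi$ is a polynomial of degree $n$). $\mathcal{P}^+$ is the set of all (nonzero) polynomials with only real and non-positive zeros. The Laguerre–Pólya class $\mathcal{LP}$ is the set of entire functions that are limits, uniformly on compact subsets of $\mathbb{C}$, of real polynomials with only real zeros; $\mathcal{LP}^+$ is the set of functions in $\mathcal{LP}$ with non-negative Taylor coefficients (equivalently, functions $Cz^Me^{az}\prod_j(1+\rho_jz)$ with $a,C\ge0$, $M\in\mathbb{N}$, $\rho_j\ge0$, $\sum_j\rho_j<\infty$).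
   Formalization: P⁺ is taken to be the nonzero polynomials with only real non-positive zeros and non-negative coefficients; without this sign normalisation the claim fails, e.g. for α=(−1,0,0,…), where (i) holds but U_α(e^z)=−Σz^k/k!² has negative coefficients. *)

theory Defs
  imports
    "HOL-Complex_Analysis.Complex_Analysis"
    "HOL-Computational_Algebra.Polynomial_FPS"
begin

text \<open>
  All coefficients live in \<open>complex\<close>: an entire function is represented by its Taylor series
  at the origin and a polynomial by the corresponding power series, so that a single operator
  covers polynomials, entire functions and formal power series.
\<close>

text \<open>
  The coefficient of index \<open>k - j\<close> vanishes for \<open>j > k\<close>. Subtraction on \<open>nat\<close>
  truncates, so the sum is cut off at \<open>j = k\<close> explicitly.
\<close>

definition U :: "(nat \<Rightarrow> real) \<Rightarrow> complex fps \<Rightarrow> complex fps" where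
  "U \<alpha> F = Abs_fps (\<lambda>k. \<Sum>j\<le>k. of_real (\<alpha> j) * fps_nth F (k - j) * fps_nth F (k + j))"

text \<open>
  A polynomial whose zeros are all real and non-positive is a constant multiple of one with
  non-negative coefficients. \<open>P_plus\<close> contains only the representatives with
  non-negative coefficients, matching the normalisation in \<open>LP_plus\<close>. Since
  \<open>U \<alpha> (c F) = c\<^sup>2 U \<alpha> F\<close>, this loses no arguments of
  \<open>U \<alpha>\<close>, but it does fix the sign of the values: for \<open>\<alpha> = (-1, 0, 0, \<dots>)\<close>,
  where \<open>U\<close> negates the squared coefficients, the polynomials \<open>U \<alpha> p\<close> have
  real non-positive zeros, while \<open>U \<alpha> (exp z)\<close> has negative coefficients.
\<close>

definition P_plus :: "complex poly set" where
  "P_plus = {p. p \<noteq> 0 \<and> (\<forall>k. coeff p k \<in> \<real>\<^sub>\<ge>\<^sub>0) \<and>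
     (\<forall>z. poly p z = 0 \<longrightarrow> z \<in> \<real> \<and> Re z \<le> 0)}"

text \<open>
  The approximating polynomials are automatically nonzero, since every complex number is a
  zero of the zero polynomial.
\<close>

definition LP :: "(complex \<Rightarrow> complex) set" where
  "LP = {f. f holomorphic_on UNIV \<and>
     (\<exists>p :: nat \<Rightarrow> real poly.
        (\<forall>n. \<forall>z::complex. poly (map_poly of_real (p n)) z = 0 \<longrightarrow> z \<in> \<real>) \<and>
        (\<forall>K. compact K \<longrightarrow>
           uniform_limit K (\<lambda>n z. poly (map_poly of_real (p n)) z) f sequentially))}"

definition taylor :: "(complex \<Rightarrow> complex) \<Rightarrow> complex fps" where
  "taylor f = fps_expansion f 0"

definition LP_plus :: "(complex \<Rightarrow> complex) set" where
  "LP_plus = {f \<in> LP. \<forall>k. fps_nth (taylor f) k \<in> \<real>\<^sub>\<ge>\<^sub>0}"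

end

theory Submission
  imports Defs "HOL-Computational_Algebra.Fundamental_Theorem_Algebra"
begin

text \<open>
  Write \<open>U\<^sub>\<alpha>(e\<^sup>z) = F(z) = \<Sum>\<^sub>m c\<^sub>m z\<^sup>m\<close> and \<open>p = \<Prod>\<^sub>i (z + s\<^sub>i)\<close> with \<open>s\<^sub>i \<ge> 0\<close>. Then
  \<open>p(w u) p(w / u)\<close> is the polynomial
  \<open>K\<^sub>w(y) = \<Prod>\<^sub>i (w\<^sup>2 + s\<^sub>i\<^sup>2 + s\<^sub>i w y)\<close> at \<open>y = u + 1/u\<close>, and comparing the
  coefficients of \<open>u\<^sup>2\<^sup>j\<close> gives \<open>U\<^sub>\<alpha>(p)(w\<^sup>2) = [F(D\<^sup>2) K\<^sub>w](0)\<close> with \<open>D = d/dy\<close>.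
  For \<open>Re w > 0\<close> all zeros of \<open>K\<^sub>w\<close> lie in the open left half-plane. If \<open>F\<close> is a polynomial
  with non-positive zeros, then \<open>F(D\<^sup>2)\<close> is, up to a constant, a product of operators \<open>D - i t\<close>
  with real \<open>t\<close>, which keep the zeros there; hence \<open>U\<^sub>\<alpha>(p)\<close> has no zeros outside the
  non-positive half-line. General \<open>F\<close> are reached by Hurwitz' theorem, since the Jensen
  polynomials of \<open>F\<close> converge to \<open>F\<close> and have non-positive zeros. Conversely, coefficientwise
  limits of polynomials with non-negative coefficients and real zeros are in the
  Laguerre-Polya class because \<open>p(x) \<le> p(0) exp (x p'(0) / p(0))\<close> for \<open>x \<ge> 0\<close>; this
  applies to the images of \<open>(1 + z/n)\<^sup>n\<close> and of the Jensen polynomials.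
\<close>

text \<open>The fundamental theorem of algebra splits off one root at a time, and the quotient
  inherits the root condition \<open>R\<close>. Claims about a product over all zeros thus reduce to
  one linear factor.\<close>

lemma poly_roots_induct [consumes 2, case_names const root]:
  fixes p :: "complex poly"
  assumes "p \<noteq> 0" "\<forall>z. poly p z = 0 \<longrightarrow> R z"
    and "\<And>c. c \<noteq> 0 \<Longrightarrow> Q [:c:]"
    and "\<And>a p. R a \<Longrightarrow> p \<noteq> 0 \<Longrightarrow> \<forall>z. poly p z = 0 \<longrightarrow> R z \<Longrightarrow> Q p \<Longrightarrow> Q ([:-a, 1:] * p)"
  shows "Q p"
  using assms(1,2)
proof (induction "degree p" arbitrary: p rule: less_induct)
  case less
  show ?case
  proof (cases "degree p = 0")
    case True
    then obtain c where "p = [:c:]"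
      by (auto elim: degree_eq_zeroE)
    then show ?thesis
      using less.prems assms(3) by auto
  next
    case False
    then obtain z where z: "poly p z = 0"
      using fundamental_theorem_of_algebra_alt[of p] by fastforce
    then obtain q where q: "p = [:-z, 1:] * q"
      by (metis dvdE poly_eq_0_iff_dvd)
    have "q \<noteq> 0"
      using q less.prems by auto
    then have "degree p = Suc (degree q)"
      unfolding q by (subst degree_mult_eq) auto
    then have "Q q"
      using less.hyps[of q] \<open>q \<noteq> 0\<close> less.prems(2) q by auto
    then show ?thesis
      unfolding q using assms(4)[of z q] \<open>q \<noteq> 0\<close> less.prems(2) q z by auto
  qed
qed

subsection \<open>Differential operators preserving zero-free half-planes\<close>

definition zero_free :: "complex set \<Rightarrow> complex poly \<Rightarrow> bool" where
  "zero_free S p \<longleftrightarrow> p = 0 \<or> (\<forall>z\<in>S. poly p z \<noteq> 0)"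

text \<open>\<open>L\<close> is the logarithmic derivative, the sum of \<open>1 / (y - z)\<close>
  over the zeros \<open>z\<close>. By \<open>sep\<close> each \<open>\<omega> * (y - z)\<close> lies
  in the upper half-plane, so its reciprocal lies in the lower one. Constant \<open>q\<close> gives
  the empty sum, hence the extra case.\<close>

lemma log_deriv_halfplane:
  assumes sep: "\<And>y z. y \<in> S \<Longrightarrow> z \<notin> S \<Longrightarrow> Im (\<omega> * (y - z)) > 0"
    and "q \<noteq> 0" "\<forall>z. poly q z = 0 \<longrightarrow> z \<notin> S" and y: "y \<in> S"
  shows "\<exists>L. poly (pderiv q) y = poly q y * L \<and> (pderiv q = 0 \<and> L = 0 \<or> Im (L / \<omega>) < 0)"
  using assms(2,3)
proof (induction q rule: poly_roots_induct)
  case (const c)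
  show ?case
    by (intro exI[of _ 0]) (simp add: pderiv_pCons)
next
  case (root z q)
  then obtain L where L: "poly (pderiv q) y = poly q y * L"
      "pderiv q = 0 \<and> L = 0 \<or> Im (L / \<omega>) < 0"
    by blast
  have *: "Im (\<omega> * (y - z)) > 0"
    using sep root.hyps(1) y by blast
  then have "y \<noteq> z"
    by auto
  have "Im (inverse (\<omega> * (y - z))) < 0"
    using * by (auto simp del: times_complex.sel inverse_mult_distrib
        simp: divide_neg_pos sum_power2_gt_zero_iff)
  then have neg: "Im (1 / (y - z) / \<omega>) < 0"
    by (simp add: field_simps)
  show ?case
  proof (intro exI[of _ "1 / (y - z) + L"] conjI disjI2)
    show "poly (pderiv ([:- z, 1:] * q)) y = poly ([:- z, 1:] * q) y * (1 / (y - z) + L)"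
      unfolding pderiv_mult using \<open>y \<noteq> z\<close> L(1) by (simp add: pderiv_pCons field_simps)
    show "Im ((1 / (y - z) + L) / \<omega>) < 0"
      using neg L(2) by (auto simp: add_divide_distrib)
  qed
qed

text \<open>For nonconstant \<open>q\<close>, a zero in \<open>S\<close> would make the logarithmic
  derivative equal to \<open>\<zeta>\<close>, which is impossible since
  \<open>\<zeta> / \<omega>\<close> is real while \<open>Im (L / \<omega>) < 0\<close>. The case
  \<open>\<zeta> = 0\<close> is a form of the Gauss-Lucas theorem.\<close>

lemma zero_free_deriv_minus_const:
  assumes sep: "\<And>y z. y \<in> S \<Longrightarrow> z \<notin> S \<Longrightarrow> Im (\<omega> * (y - z)) > 0"
    and q: "zero_free S q" and \<zeta>: "\<zeta> / \<omega> \<in> \<real>"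
  shows "zero_free S (pderiv q - smult \<zeta> q)"
proof (cases "q = 0")
  case False
  with q have nz: "\<forall>z. poly q z = 0 \<longrightarrow> z \<notin> S"
    by (auto simp: zero_free_def)
  show ?thesis
  proof (cases "pderiv q = 0")
    case True
    then show ?thesis
      using nz by (auto simp: zero_free_def)
  next
    case nc: False
    have "poly (pderiv q - smult \<zeta> q) y \<noteq> 0" if y: "y \<in> S" for y
    proof
      obtain L where L: "poly (pderiv q) y = poly q y * L" "Im (L / \<omega>) < 0"
        using log_deriv_halfplane[OF sep False nz y] nc by blast
      assume "poly (pderiv q - smult \<zeta> q) y = 0"
      then have "L = \<zeta>"
        using L(1) nz y by auto
      then show False
        using L(2) \<zeta> by (auto simp: complex_is_Real_iff)
    qed
    then show ?thesis
      by (auto simp: zero_free_def)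
  qed
qed (auto simp: zero_free_def)

section \<open>Differential operators \<open>p(D)\<close> with \<open>D = d/dz\<close>, written
  \<open>diff_op p\<close>\<close>

definition diff_op :: "complex poly \<Rightarrow> complex poly \<Rightarrow> complex poly" where
  "diff_op p q = (\<Sum>i\<le>degree p. smult (coeff p i) ((pderiv ^^ i) q))"

lemma diff_op_altdef:
  assumes "degree p \<le> n"
  shows "diff_op p q = (\<Sum>i\<le>n. smult (coeff p i) ((pderiv ^^ i) q))"
  unfolding diff_op_def using assms
  by (intro sum.mono_neutral_left) (auto simp: coeff_eq_0)

lemma pderiv_sum: "pderiv (\<Sum>x\<in>A. f x) = (\<Sum>x\<in>A. pderiv (f x))"
  by (induction A rule: infinite_finite_induct) (auto simp: pderiv_add)

lemma smult_sum_right: "smult c (\<Sum>x\<in>A. f x) = (\<Sum>x\<in>A. smult c (f x))"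
  by (induction A rule: infinite_finite_induct) (auto simp: smult_add_right)

text \<open>Composition of operators corresponds to multiplication of symbols, so a factorisation of
  \<open>p\<close> lets \<open>p(D)\<close> act as successive operators
  \<open>D - \<zeta>\<close>.\<close>

lemma diff_op_linear_mult:
  "diff_op ([:- \<zeta>, 1:] * p) q = pderiv (diff_op p q) - smult \<zeta> (diff_op p q)"
proof -
  define n where "n = degree p"
  have "degree ([:- \<zeta>, 1:] * p) \<le> Suc n"
    unfolding n_def by (metis degree_mult_le degree_pCons_eq_if one_neq_zero pCons_eq_0_iff
      plus_1_eq_Suc degree_1 One_nat_def one_pCons)
  then have "diff_op ([:- \<zeta>, 1:] * p) q
      = (\<Sum>i\<le>Suc n. smult (coeff (pCons 0 p) i) ((pderiv ^^ i) q))
        - (\<Sum>i\<le>Suc n. smult (coeff (smult \<zeta> p) i) ((pderiv ^^ i) q))"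
    by (subst diff_op_altdef) (auto simp flip: sum_subtractf simp: smult_diff_left)
  also have "(\<Sum>i\<le>Suc n. smult (coeff (pCons 0 p) i) ((pderiv ^^ i) q)) = pderiv (diff_op p q)"
    by (subst sum.atMost_Suc_shift)
       (simp add: diff_op_def n_def pderiv_sum pderiv_smult)
  also have "(\<Sum>i\<le>Suc n. smult (coeff (smult \<zeta> p) i) ((pderiv ^^ i) q)) = smult \<zeta> (diff_op p q)"
    by (subst diff_op_altdef[of p "Suc n"]) (auto simp: n_def smult_sum_right smult_add_right)
  finally show ?thesis .
qed

lemma zero_free_diff_op:
  assumes sep: "\<And>y z. y \<in> S \<Longrightarrow> z \<notin> S \<Longrightarrow> Im (\<omega> * (y - z)) > 0"
    and "p \<noteq> 0" and "\<forall>\<zeta>. poly p \<zeta> = 0 \<longrightarrow> \<zeta> / \<omega> \<in> \<real>" and q: "zero_free S q"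
  shows "zero_free S (diff_op p q)"
  using assms(2,3)
proof (induction p rule: poly_roots_induct)
  case (const c)
  then show ?case
    using q by (auto simp: diff_op_def zero_free_def)
next
  case (root \<zeta> p)
  show ?case
    unfolding diff_op_linear_mult
    by (rule zero_free_deriv_minus_const[OF sep root.IH]) (use root.hyps in auto)
qed

subsection \<open>Limits of zero-free functions\<close>

lemma uniform_limit_sum:
  fixes f :: "'a \<Rightarrow> 'b \<Rightarrow> 'c \<Rightarrow> 'd :: real_normed_vector"
  assumes "\<And>i. i \<in> I \<Longrightarrow> uniform_limit K (f i) (g i) F"
  shows "uniform_limit K (\<lambda>n x. \<Sum>i\<in>I. f i n x) (\<lambda>x. \<Sum>i\<in>I. g i x) F"
  using assms by (induction I rule: infinite_finite_induct)
    (auto intro: uniform_limit_add uniform_limit_const)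

text \<open>Hurwitz' theorem as a dichotomy. For finite combinations of fixed holomorphic functions,
  convergence of the coefficients already gives uniform convergence on compact sets.\<close>

lemma zero_free_limit:
  fixes h :: "nat \<Rightarrow> complex \<Rightarrow> complex" and c :: "nat \<Rightarrow> nat \<Rightarrow> complex"
  assumes S: "open S" "connected S" and hol: "\<And>m. h m holomorphic_on S"
    and lim: "\<And>m. (\<lambda>n. c n m) \<longlonglongrightarrow> d m"
    and zf: "\<And>n. (\<forall>z\<in>S. (\<Sum>m\<le>N. c n m * h m z) = 0) \<or> (\<forall>z\<in>S. (\<Sum>m\<le>N. c n m * h m z) \<noteq> 0)"
  shows "(\<forall>z\<in>S. (\<Sum>m\<le>N. d m * h m z) = 0) \<or> (\<forall>z\<in>S. (\<Sum>m\<le>N. d m * h m z) \<noteq> 0)"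
proof (rule ccontr)
  define F where "F = (\<lambda>n z. \<Sum>m\<le>N. c n m * h m z)"
  define G where "G = (\<lambda>z. \<Sum>m\<le>N. d m * h m z)"
  assume "\<not> ?thesis"
  then obtain z1 z0 where z: "z1 \<in> S" "G z1 \<noteq> 0" "z0 \<in> S" "G z0 = 0"
    by (auto simp: G_def)
  \<comment> \<open>For large \<open>n\<close>, nonvanishing of \<open>F n\<close> at the single
    point \<open>z1\<close> excludes the identically zero alternative.\<close>
  have "(\<lambda>n. F n z1) \<longlonglongrightarrow> G z1"
    unfolding F_def G_def by (intro tendsto_intros lim)
  then have "eventually (\<lambda>n. F n z1 \<noteq> 0) sequentially"
    using z(2) by (rule tendsto_imp_eventually_ne)
  then obtain n0 where n0: "\<And>n. n \<ge> n0 \<Longrightarrow> F n z1 \<noteq> 0"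
    by (auto simp: eventually_sequentially)
  have nz: "F (n + n0) z \<noteq> 0" if "z \<in> S" for n z
    using zf[of "n + n0"] n0[of "n + n0"] that z(1) by (auto simp: F_def)
  have ul: "uniform_limit K (\<lambda>n. F (n + n0)) G sequentially" if K: "compact K" "K \<subseteq> S" for K
  proof -
    have "uniform_limit K (\<lambda>n z. c (n + n0) m * h m z) (\<lambda>z. d m * h m z) sequentially" for m
    proof (rule uniform_lim_mult)
      show "uniform_limit K (\<lambda>n z. c (n + n0) m) (\<lambda>z. d m) sequentially"
      proof (rule uniform_limitI)
        fix e :: real assume "e > 0"
        have "(\<lambda>n. c (n + n0) m) \<longlonglongrightarrow> d m"
          using lim by (rule LIMSEQ_ignore_initial_segment)
        then show "\<forall>\<^sub>F n in sequentially. \<forall>z\<in>K. dist (c (n + n0) m) (d m) < e"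
          using \<open>e > 0\<close> by (auto dest: tendstoD elim: eventually_mono)
      qed
      show "bounded (h m ` K)"
        using hol K by (intro compact_imp_bounded compact_continuous_image)
          (auto intro: holomorphic_on_imp_continuous_on holomorphic_on_subset)
    qed (auto intro: bounded_subset[of "{d m}"] uniform_limit_const)
    then show ?thesis
      unfolding F_def G_def by (intro uniform_limit_sum)
  qed
  have "\<not> G constant_on S"
    using z unfolding constant_on_def by metis
  then have "G z0 \<noteq> 0"
    by (intro Hurwitz_no_zeros[OF S _ _ ul])
      (use nz z hol in \<open>auto simp: F_def G_def intro!: holomorphic_intros\<close>)
  with z show False
    by simp
qed

lemma poly_eq_0_on_open:
  fixes p :: "complex poly"
  assumes "open S" "S \<noteq> {}" "\<And>z. z \<in> S \<Longrightarrow> poly p z = 0"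
  shows "p = 0"
proof (rule ccontr)
  assume "p \<noteq> 0"
  then have "finite S"
    using poly_roots_finite[of p] assms(3) finite_subset[of S "{x. poly p x = 0}"] by auto
  then show False
    using assms(1,2) by (metis finite_imp_not_open)
qed

lemma poly_eq_sum_atMost:
  fixes p :: "complex poly"
  assumes "degree p \<le> N"
  shows "poly p z = (\<Sum>m\<le>N. coeff p m * z ^ m)"
  unfolding poly_altdef using assms
  by (intro sum.mono_neutral_left) (auto simp: coeff_eq_0)

lemma zero_free_poly_limit:
  assumes S: "open S" "connected S" "S \<noteq> {}"
    and deg: "\<And>n. degree (p n) \<le> N" "degree q \<le> N"
    and lim: "\<And>m. (\<lambda>n. coeff (p n) m) \<longlonglongrightarrow> coeff q m"
    and zf: "\<And>n. zero_free S (p n)"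
  shows "zero_free S q"
proof -
  have "(\<forall>z\<in>S. (\<Sum>m\<le>N. coeff q m * z ^ m) = 0) \<or> (\<forall>z\<in>S. (\<Sum>m\<le>N. coeff q m * z ^ m) \<noteq> 0)"
  proof (rule zero_free_limit[OF S(1,2) _ lim])
    fix n
    show "(\<forall>z\<in>S. (\<Sum>m\<le>N. coeff (p n) m * z ^ m) = 0) \<or> (\<forall>z\<in>S. (\<Sum>m\<le>N. coeff (p n) m * z ^ m) \<noteq> 0)"
      using zf[of n] unfolding poly_eq_sum_atMost[OF deg(1), symmetric] by (auto simp: zero_free_def)
  qed (auto intro!: holomorphic_intros)
  then show ?thesis
    unfolding poly_eq_sum_atMost[OF deg(2), symmetric]
    using poly_eq_0_on_open[OF S(1,3), of q] by (auto simp: zero_free_def)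
qed

subsection \<open>Jensen polynomials\<close>

text \<open>A nonzero polynomial with nonnegative coefficients is positive at every positive real,
  so its real zeros are automatically nonpositive.\<close>

lemma P_plusI:
  assumes "p \<noteq> 0" "\<And>k. coeff p k \<in> \<real>\<^sub>\<ge>\<^sub>0" "\<And>z. poly p z = 0 \<Longrightarrow> z \<in> \<real>"
  shows "p \<in> P_plus"
proof -
  have "Re z \<le> 0" if z: "poly p z = 0" for z
  proof (rule ccontr)
    assume "\<not> Re z \<le> 0"
    then obtain x where x: "z = of_real x" "x > 0"
      using assms(3)[OF z] by (auto elim!: Reals_cases)
    define a where "a = (\<lambda>k. Re (coeff p k))"
    have a: "coeff p k = of_real (a k)" "a k \<ge> 0" for k
      using assms(2)[of k] by (auto simp: a_def complex_nonneg_Reals_iff complex_eq_iff)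
    have "a (degree p) > 0"
      using a[of "degree p"] assms(1) by (metis leading_coeff_0_iff less_eq_real_def of_real_0)
    then have "(\<Sum>k\<le>degree p. a k * x ^ k) > 0"
      using x a(2) by (intro sum_pos2[of _ "degree p"]) auto
    moreover have "poly p z = of_real (\<Sum>k\<le>degree p. a k * x ^ k)"
      by (simp add: poly_altdef a(1) x(1))
    ultimately show False
      using z by (metis less_irrefl of_real_eq_0_iff)
  qed
  then show ?thesis
    using assms by (auto simp: P_plus_def)
qed

text \<open>Classically \<open>\<Sum> (n choose j) * \<gamma>_j * (z / n) ^ j\<close> with
  \<open>\<gamma>_j = j! * a_j\<close>; scaling by \<open>n\<close> makes the coefficients converge
  to those of \<open>F\<close>.\<close>

definition jensen :: "complex fps \<Rightarrow> nat \<Rightarrow> complex poly" where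
  "jensen F n = (\<Sum>j\<le>n. monom (fps_nth F j * (fact j * of_nat (n choose j) / of_nat n ^ j)) j)"

lemma coeff_jensen:
  "coeff (jensen F n) j = fps_nth F j * (fact j * of_nat (n choose j) / of_nat n ^ j)"
  by (simp add: jensen_def coeff_sum sum.delta)

text \<open>For \<open>n > 0\<close> the quotient is the product of \<open>1 - i / n\<close> over
  \<open>i < j\<close>, a fixed number of factors tending to 1.\<close>

lemma falling_factorial_over_power_tendsto_1:
  "(\<lambda>n. fact j * of_nat (n choose j) / of_nat n ^ j :: complex) \<longlonglongrightarrow> 1"
proof -
  have "(\<lambda>n. \<Prod>i=0..<j. 1 - of_nat i * inverse (of_nat n) :: complex) \<longlonglongrightarrow> (\<Prod>i=0..<j. 1 - of_nat i * 0)"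
    by (intro tendsto_intros lim_inverse_n)
  moreover have "eventually (\<lambda>n. (\<Prod>i=0..<j. 1 - of_nat i * inverse (of_nat n) :: complex)
      = fact j * of_nat (n choose j) / of_nat n ^ j) sequentially"
    using eventually_gt_at_top[of 0]
  proof eventually_elim
    case (elim n)
    have "fact j * of_nat (n choose j) = (\<Prod>i=0..<j. of_nat n - of_nat i :: complex)"
      by (simp add: binomial_gbinomial gbinomial_prod_rev)
    also have "\<dots> / of_nat n ^ j = (\<Prod>i=0..<j. (of_nat n - of_nat i) / of_nat n)"
      by (simp add: prod_dividef)
    also have "\<dots> = (\<Prod>i=0..<j. 1 - of_nat i * inverse (of_nat n))"
      using elim by (intro prod.cong) (auto simp: field_simps)
    finally show ?case ..
  qed
  ultimately show ?thesis
    by (auto intro: Lim_transform_eventually)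
qed

lemma coeff_jensen_tendsto: "(\<lambda>n. coeff (jensen F n) j) \<longlonglongrightarrow> fps_nth F j"
  unfolding coeff_jensen
  using tendsto_mult[OF tendsto_const falling_factorial_over_power_tendsto_1] by simp

text \<open>\<open>appell F n\<close> is \<open>F(d/dz) z\<^sup>n\<close>, the reversal of the \<open>n\<close>-th Jensen polynomial.\<close>

definition appell :: "complex fps \<Rightarrow> nat \<Rightarrow> complex poly" where
  "appell F n = (\<Sum>k\<le>n. monom (fps_nth F (n - k) * (fact n / fact k)) k)"

lemma coeff_appell:
  "coeff (appell F n) k = (if k \<le> n then fps_nth F (n - k) * (fact n / fact k) else 0)"
  by (simp add: appell_def coeff_sum sum.delta)

lemma degree_appell: "degree (appell F n) \<le> n"
  by (rule degree_le) (simp add: coeff_appell)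

text \<open>The monomial \<open>z ^ n\<close> vanishes at most at 0, so
  \<open>zero_free_diff_op\<close> applies to it in both open half-planes; this identity carries the
  result over to \<open>appell\<close>.\<close>

lemma diff_op_monom: "diff_op p (monom 1 n) = appell (fps_of_poly p) n"
proof (rule poly_eqI)
  fix k
  have "coeff (diff_op p (monom 1 n)) k
      = (\<Sum>i\<le>degree p. if i + k = n then coeff p i * pochhammer (of_nat (Suc k)) i else 0)"
    by (simp add: diff_op_def coeff_sum coeff_higher_pderiv cong: if_cong sum.cong)
       (auto intro!: sum.cong)
  also have "\<dots> = (if k \<le> n then coeff p (n - k) * pochhammer (of_nat (Suc k)) (n - k) else 0)"
  proof (cases "k \<le> n")
    case True
    then have "(i + k = n) = (i = n - k)" for i
      by auto
    then show ?thesis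
      using True by (auto simp: sum.delta coeff_eq_0)
  qed auto
  also have "\<dots> = coeff (appell (fps_of_poly p) n) k"
  proof (cases "k \<le> n")
    case True
    have "fact n = fact k * pochhammer (of_nat (Suc k) :: complex) (n - k)"
      using pochhammer_product[OF True, of 1] by (simp add: pochhammer_fact add.commute)
    then show ?thesis
      by (simp add: coeff_appell True)
  qed (auto simp: coeff_appell)
  finally show "coeff (diff_op p (monom 1 n)) k = coeff (appell (fps_of_poly p) n) k" .
qed

text \<open>The substitution \<open>n / z\<close> preserves reality, so real zeros of the Appell
  polynomial force real zeros of the Jensen polynomial.\<close>

lemma poly_jensen_eq_appell:
  assumes "n > 0" "z \<noteq> 0"
  shows "poly (jensen F n) z = (z / of_nat n) ^ n * poly (appell F n) (of_nat n / z)"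
proof -
  have "(z / of_nat n) ^ n * poly (appell F n) (of_nat n / z)
      = (\<Sum>k\<le>n. (z / of_nat n) ^ n * (fps_nth F (n - k) * (fact n / fact k) * (of_nat n / z) ^ k))"
    by (simp add: appell_def poly_sum poly_monom sum_distrib_left)
  also have "\<dots> = (\<Sum>k\<le>n. (z / of_nat n) ^ n * (fps_nth F (n - (n - k)) * (fact n / fact (n - k)) * (of_nat n / z) ^ (n - k)))"
    by (subst sum.nat_diff_reindex[symmetric, where n = "Suc n", unfolded lessThan_Suc_atMost]) simp
  also have "\<dots> = poly (jensen F n) z"
    unfolding jensen_def poly_sum poly_monom
  proof (intro sum.cong refl)
    fix k assume k: "k \<in> {..n}"
    have "(z / of_nat n) ^ n = (z / of_nat n) ^ k * (z / of_nat n) ^ (n - k)"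
      using k by (simp flip: power_add)
    moreover have "(z / of_nat n) ^ (n - k) * (of_nat n / z) ^ (n - k) = 1"
      using assms by (simp flip: power_mult_distrib)
    moreover have "fact n / fact (n - k) = (fact k * of_nat (n choose k) :: complex)"
      using k by (simp add: binomial_fact)
    ultimately show "(z / of_nat n) ^ n * (fps_nth F (n - (n - k)) * (fact n / fact (n - k)) * (of_nat n / z) ^ (n - k))
      = fps_nth F k * (fact k * of_nat (n choose k) / of_nat n ^ k) * z ^ k"
      using k by (simp add: power_divide mult_ac)
  qed
  finally show ?thesis ..
qed

section \<open>Taylor coefficients of locally uniform limits\<close>

lemma higher_deriv_poly: "(deriv ^^ m) (poly p) = poly ((pderiv ^^ m) (p :: complex poly))"
proof (induction m)
  case (Suc m)
  have "deriv (poly q) = poly (pderiv q)" for q :: "complex poly"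
    by (auto simp: fun_eq_iff intro!: DERIV_imp_deriv poly_DERIV)
  then show ?case
    by (simp add: Suc)
qed auto

text \<open>By Weierstrass' theorem, uniform convergence near 0 passes to all derivatives.\<close>

lemma coeff_tendsto_taylor:
  assumes ul: "\<And>K. compact K \<Longrightarrow> uniform_limit K (\<lambda>n. poly (p n)) f sequentially"
  shows "(\<lambda>n. coeff (p n) m) \<longlonglongrightarrow> fps_nth (taylor f) m"
proof -
  have "uniform_limit (ball 0 1) (\<lambda>n. poly (p n)) f sequentially"
    using ul[of "cball 0 1"] by (rule uniform_limit_on_subset) auto
  then have "(\<lambda>n. (deriv ^^ m) (poly (p n)) 0) \<longlonglongrightarrow> (deriv ^^ m) f 0"
    by (rule higher_deriv_complex_uniform_limit) (auto intro!: always_eventually holomorphic_intros)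
  then have "(\<lambda>n. (deriv ^^ m) (poly (p n)) 0 / fact m) \<longlonglongrightarrow> (deriv ^^ m) f 0 / fact m"
    by (intro tendsto_intros) auto
  then show ?thesis
    by (simp add: higher_deriv_poly taylor_def fps_expansion_def poly_0_coeff_0
        coeff_higher_pderiv pochhammer_fact[symmetric])
qed

lemma LP_taylor_approx:
  assumes "f \<in> LP"
  obtains p where "\<And>n. p n \<noteq> 0" "\<And>n z. poly (p n) z = 0 \<Longrightarrow> z \<in> \<real>"
    "\<And>m. (\<lambda>n. coeff (p n) m) \<longlonglongrightarrow> fps_nth (taylor f) m"
proof -
  obtain q :: "nat \<Rightarrow> real poly" where q: "\<And>n z. poly (map_poly of_real (q n)) z = 0 \<Longrightarrow> (z::complex) \<in> \<real>"
     "\<And>K. compact K \<Longrightarrow> uniform_limit K (\<lambda>n z. poly (map_poly of_real (q n)) z) f sequentially"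
    using assms unfolding LP_def by blast
  show ?thesis
  proof (rule that[of "\<lambda>n. map_poly of_real (q n)"])
    \<comment> \<open>The zero polynomial would vanish at the non-real point
      \<open>\<i>\<close>.\<close>
    show "map_poly of_real (q n) \<noteq> (0 :: complex poly)" for n
      using q(1)[of n \<i>] by (auto simp: complex_is_Real_iff)
  qed (use q coeff_tendsto_taylor in auto)
qed

text \<open>The approximants of \<open>f\<close> have only real zeros, so applying them as operators
  to \<open>z ^ n\<close> creates no zeros off the real line. The resulting coefficients depend on
  finitely many coefficients of the approximants and therefore converge.\<close>

lemma zero_free_appell:
  assumes "f \<in> LP"
  shows "zero_free {z. Im z > 0} (appell (taylor f) n)" "zero_free {z. Im z < 0} (appell (taylor f) n)"
proof -
  obtain p where p: "\<And>n. p n \<noteq> 0" "\<And>n z. poly (p n) z = 0 \<Longrightarrow> z \<in> \<real>"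
    "\<And>m. (\<lambda>n. coeff (p n) m) \<longlonglongrightarrow> fps_nth (taylor f) m"
    by (rule LP_taylor_approx[OF assms]) blast
  have lim: "(\<lambda>k. coeff (appell (fps_of_poly (p k)) n) m) \<longlonglongrightarrow> coeff (appell (taylor f) n) m" for m
    unfolding coeff_appell by (auto intro!: tendsto_intros p(3))
  have "zero_free {z. Im z > 0} (appell (fps_of_poly (p k)) n)" for k
    unfolding diff_op_monom[symmetric]
    by (rule zero_free_diff_op[where \<omega> = 1])
       (use p in \<open>auto simp: zero_free_def poly_monom\<close>)
  then show "zero_free {z. Im z > 0} (appell (taylor f) n)"
    by (intro zero_free_poly_limit[OF _ _ _ degree_appell degree_appell lim])
       (auto simp: open_halfspace_Im_gt convex_connected convex_halfspace_Im_gt intro: exI[of _ \<i>])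
  have "zero_free {z. Im z < 0} (appell (fps_of_poly (p k)) n)" for k
    unfolding diff_op_monom[symmetric]
    by (rule zero_free_diff_op[where \<omega> = "-1"])
       (use p in \<open>auto simp: zero_free_def poly_monom\<close>)
  then show "zero_free {z. Im z < 0} (appell (taylor f) n)"
    by (intro zero_free_poly_limit[OF _ _ _ degree_appell degree_appell lim])
       (auto simp: open_halfspace_Im_lt convex_connected convex_halfspace_Im_lt intro: exI[of _ "-\<i>"])
qed

lemma jensen_in_P_plus:
  assumes "f \<in> LP_plus" and n: "n > 0"
  shows "jensen (taylor f) n \<in> P_plus \<union> {0}"
proof (cases "jensen (taylor f) n = 0")
  case False
  have f: "f \<in> LP" "\<And>k. fps_nth (taylor f) k \<in> \<real>\<^sub>\<ge>\<^sub>0"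
    using assms by (auto simp: LP_plus_def)
  obtain j where j: "coeff (jensen (taylor f) n) j \<noteq> 0"
    using False by (auto simp: poly_eq_iff)
  then have "j \<le> n" "fps_nth (taylor f) j \<noteq> 0"
    by (auto simp: coeff_jensen intro: ccontr)
  \<comment> \<open>Coefficient \<open>n - j\<close> of the reversal survives, which rules out the
    zero case of \<open>zero_free\<close>.\<close>
  then have "coeff (appell (taylor f) n) (n - j) \<noteq> 0"
    by (simp add: coeff_appell)
  then have nz: "appell (taylor f) n \<noteq> 0"
    by auto
  have "jensen (taylor f) n \<in> P_plus"
  proof (rule P_plusI[OF False])
    show "coeff (jensen (taylor f) n) k \<in> \<real>\<^sub>\<ge>\<^sub>0" for k
    proof -
      have "fact k * of_nat (n choose k) / of_nat n ^ k
          = (of_real (fact k * real (n choose k) / real n ^ k) :: complex)"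
        by simp
      also have "\<dots> \<in> \<real>\<^sub>\<ge>\<^sub>0"
        by (subst nonneg_Reals_of_real_iff) simp
      finally show ?thesis
        unfolding coeff_jensen using f(2) nonneg_Reals_mult_I by blast
    qed
  next
    fix z assume z: "poly (jensen (taylor f) n) z = 0"
    show "z \<in> \<real>"
    proof (cases "z = 0")
      case False
      have "poly (appell (taylor f) n) (of_nat n / z) = 0"
        using poly_jensen_eq_appell[OF n False, of "taylor f"] z False n by simp
      then have "of_nat n / z \<in> \<real>"
        using zero_free_appell[OF f(1), of n] nz
        by (force simp: zero_free_def complex_is_Real_iff not_less_iff_gr_or_eq)
      then have "of_nat n / (of_nat n / z) \<in> \<real>"
        by (rule Reals_divide[OF Reals_of_nat])
      also have "of_nat n / (of_nat n / z) = z"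
        using n False by (simp add: field_simps)
      finally show ?thesis .
    qed auto
  qed
  then show ?thesis ..
qed auto

subsection \<open>Coefficientwise limits\<close>

text \<open>With zeros \<open>-s\<close>, the witnesses are \<open>t = \<Prod> (1 + x / s)\<close>
  and \<open>u = \<Sum> 1 / s\<close>; the bound is \<open>1 + y \<le> exp y\<close> applied factor
  by factor.\<close>

lemma poly_exp_bound_aux:
  fixes p :: "complex poly" and x :: real
  assumes "p \<noteq> 0" "\<forall>z. poly p z = 0 \<longrightarrow> z \<in> \<real> \<and> Re z < 0" "x \<ge> 0"
  shows "\<exists>t u :: real. coeff p 0 \<noteq> 0 \<and> poly p (of_real x) = coeff p 0 * of_real t \<and>
           coeff p 1 = coeff p 0 * of_real u \<and> 0 \<le> t \<and> t \<le> exp (x * u)"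
  using assms(1,2)
proof (induction p rule: poly_roots_induct)
  case (const c)
  then show ?case
    by (intro exI[of _ 1] exI[of _ 0]) auto
next
  case (root a p)
  define s where "s = - Re a"
  have s: "s > 0" "a = - of_real s"
    using root.hyps(1) by (auto simp: s_def complex_is_Real_iff complex_eq_iff)
  obtain t u :: real where tu: "coeff p 0 \<noteq> 0" "poly p (of_real x) = coeff p 0 * of_real t"
      "coeff p 1 = coeff p 0 * of_real u" "0 \<le> t" "t \<le> exp (x * u)"
    using root.IH by blast
  have c: "coeff ([:- a, 1:] * p) 0 = of_real s * coeff p 0"
    "coeff ([:- a, 1:] * p) 1 = of_real s * coeff p 1 + coeff p 0"
    by (simp_all add: s(2))
  have "(1 + x / s) * t \<le> exp (x / s) * exp (x * u)"
    using tu(4,5) assms(3) s(1) exp_ge_add_one_self[of "x / s"] by (intro mult_mono) auto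
  then have "(1 + x / s) * t \<le> exp (x * (u + 1 / s))"
    by (simp add: algebra_simps flip: exp_add)
  then show ?case
    using s(1) assms(3) tu
    by (intro exI[of _ "(1 + x / s) * t"] exI[of _ "u + 1 / s"], unfold c)
       (simp add: s(2) field_simps)
qed

lemma norm_poly_P_plus_le:
  assumes p: "p \<in> P_plus" "coeff p 0 \<noteq> 0" and x: "x \<ge> 0"
  shows "norm (poly p (of_real x)) \<le> norm (coeff p 0) * exp (x * (norm (coeff p 1) / norm (coeff p 0)))"
proof -
  have "\<forall>z. poly p z = 0 \<longrightarrow> z \<in> \<real> \<and> Re z < 0"
  proof (intro allI impI)
    fix z assume z: "poly p z = 0"
    then have "z \<in> \<real>" "Re z \<le> 0"
      using p by (auto simp: P_plus_def)
    moreover have "z \<noteq> 0"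
      using z p by (auto simp: poly_0_coeff_0)
    ultimately show "z \<in> \<real> \<and> Re z < 0"
      by (auto simp: complex_is_Real_iff complex_eq_iff)
  qed
  then obtain t u :: real where tu: "poly p (of_real x) = coeff p 0 * of_real t"
      "coeff p 1 = coeff p 0 * of_real u" "0 \<le> t" "t \<le> exp (x * u)"
    using poly_exp_bound_aux[of p x] p x by (auto simp: P_plus_def)
  have "norm (coeff p 1) / norm (coeff p 0) = \<bar>u\<bar>"
    using tu p(2) by (simp add: norm_mult)
  moreover have "t \<le> exp (x * \<bar>u\<bar>)"
    using tu(4) x by (smt (verit) exp_le_cancel_iff mult_left_mono)
  ultimately show ?thesis
    using tu by (simp add: norm_mult mult_left_mono)
qed

lemma coeff_le_poly_P_plus:
  assumes p: "p \<in> P_plus" and x: "x \<ge> 0"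
  shows "norm (coeff p k) * x ^ k \<le> norm (poly p (of_real x))"
proof (cases "k \<le> degree p")
  case True
  have c: "coeff p i = of_real (norm (coeff p i))" for i
    using p by (auto simp: P_plus_def complex_eq_iff complex_nonneg_Reals_iff nonneg_Reals_cmod_eq_Re)
  have "norm (coeff p k) * x ^ k \<le> (\<Sum>i\<le>degree p. norm (coeff p i) * x ^ i)"
    using x True by (intro member_le_sum) auto
  also have "\<dots> = norm (of_real (\<Sum>i\<le>degree p. norm (coeff p i) * x ^ i) :: complex)"
    unfolding norm_of_real using x by (intro abs_of_nonneg[symmetric] sum_nonneg) auto
  also have "of_real (\<Sum>i\<le>degree p. norm (coeff p i) * x ^ i) = poly p (of_real x)"
    unfolding poly_altdef of_real_sum of_real_mult of_real_power c[symmetric] ..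
  finally show ?thesis .
qed (simp add: coeff_eq_0)

lemma higher_pderiv_P_plus:
  assumes "p \<in> P_plus \<union> {0}"
  shows "(pderiv ^^ m) p \<in> P_plus \<union> {0}"
proof (induction m)
  case (Suc m)
  define q where "q = (pderiv ^^ m) p"
  have "pderiv q \<in> P_plus" if nz: "pderiv q \<noteq> 0"
  proof (rule P_plusI[OF nz])
    have q: "q \<in> P_plus"
      using Suc nz by (auto simp: q_def)
    then show "coeff (pderiv q) k \<in> \<real>\<^sub>\<ge>\<^sub>0" for k
      by (auto simp: coeff_pderiv P_plus_def intro!: nonneg_Reals_mult_I nonneg_Reals_add_I)
    \<comment> \<open>Differentiation is the operator \<open>D - \<zeta>\<close> with
      \<open>\<zeta> = 0\<close>, so the half-plane lemma applies above and below the real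
      line.\<close>
    have "zero_free {z. Im z > 0} (pderiv q - smult 0 q)"
      by (rule zero_free_deriv_minus_const[where \<omega> = 1])
         (use q in \<open>auto simp: P_plus_def zero_free_def complex_is_Real_iff\<close>)
    moreover have "zero_free {z. Im z < 0} (pderiv q - smult 0 q)"
      by (rule zero_free_deriv_minus_const[where \<omega> = "-1"])
         (use q in \<open>auto simp: P_plus_def zero_free_def complex_is_Real_iff\<close>)
    ultimately show "z \<in> \<real>" if "poly (pderiv q) z = 0" for z
      using that nz by (force simp: zero_free_def complex_is_Real_iff not_less_iff_gr_or_eq)
  qed
  then show ?case
    by (auto simp: q_def)
qed (use assms in auto)

text \<open>Coefficientwise convergence becomes uniform convergence on compact sets through a bound
  on \<open>norm (coeff (P n) k) * R ^ k\<close> valid for all \<open>n\<close> and \<open>k\<close>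
  at once. The exponential estimate needs a nonzero constant term, hence the passage to an
  \<open>M\<close>-th derivative.\<close>

lemma P_plus_tendsto_LP_plus:
  assumes p: "\<And>n. p n \<in> P_plus \<union> {0}" and lim: "\<And>k. (\<lambda>n. coeff (p n) k) \<longlonglongrightarrow> fps_nth F k"
  shows "F \<in> taylor ` LP_plus \<union> {0}"
proof (cases "F = 0")
  case False
  then obtain M where M: "fps_nth F M \<noteq> 0"
    by (auto simp: fps_eq_iff)
  have "eventually (\<lambda>n. coeff (p n) M \<noteq> 0) sequentially"
    by (rule tendsto_imp_eventually_ne[OF lim M])
  then obtain n0 where n0: "\<And>n. n \<ge> n0 \<Longrightarrow> coeff (p n) M \<noteq> 0"
    by (auto simp: eventually_sequentially)
  \<comment> \<open>The shift by \<open>n0\<close> keeps coefficient \<open>M\<close> nonzero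
    throughout; up to a factor it becomes the constant term of \<open>Q n\<close>.\<close>
  define P where "P = (\<lambda>n. p (n + n0))"
  have PM: "coeff (P n) M \<noteq> 0" for n
    using n0 by (simp add: P_def)
  have P: "P n \<in> P_plus" for n
    using p[of "n + n0"] PM[of n] by (auto simp: P_def)
  have limP: "(\<lambda>n. coeff (P n) k) \<longlonglongrightarrow> fps_nth F k" for k
    unfolding P_def using lim by (rule LIMSEQ_ignore_initial_segment)

  define Q where "Q = (\<lambda>n. (pderiv ^^ M) (P n))"
  have coeffQ: "coeff (Q n) k = pochhammer (of_nat (Suc k)) M * coeff (P n) (k + M)" for n k
    by (simp add: Q_def coeff_higher_pderiv add.commute)
  \<comment> \<open>Since this factor has norm at least 1, the coefficients of \<open>P n\<close>
    from index \<open>M\<close> on are dominated by those of \<open>Q n\<close>.\<close>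
  have poch: "norm (pochhammer (of_nat (Suc k)) M :: complex) \<ge> 1" for k
  proof -
    have "pochhammer (of_nat (Suc k)) M = (of_nat (pochhammer (Suc k) M) :: complex)"
      by (simp only: pochhammer_of_nat)
    moreover have "pochhammer (Suc k) M \<ge> 1"
      by (metis Suc_leI One_nat_def pochhammer_pos zero_less_Suc)
    ultimately show ?thesis
      by (metis norm_of_nat of_nat_1 of_nat_mono)
  qed
  define c where "c = (\<lambda>k. pochhammer (of_nat (Suc k)) M * fps_nth F (k + M))"
  have limQ: "(\<lambda>n. coeff (Q n) k) \<longlonglongrightarrow> c k" for k
    unfolding coeffQ c_def by (intro tendsto_intros limP)
  have Q0: "coeff (Q n) 0 \<noteq> 0" for n
    using poch[of 0] PM[of n] by (auto simp: coeffQ)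
  have Q: "Q n \<in> P_plus" for n
    using higher_pderiv_P_plus[of "P n" M] P[of n] Q0[of n] by (auto simp: Q_def)

  \<comment> \<open>The first \<open>M\<close> coefficients are finitely many convergent sequences.
    The others are controlled by the value of \<open>Q n\<close> at \<open>R\<close>, hence by
    \<open>E n\<close>, which converges because \<open>c 0\<close> is nonzero.\<close>
  have bound: "\<exists>B. \<forall>n k. norm (coeff (P n) k) * R ^ k \<le> B" if R: "R \<ge> 0" for R :: real
  proof -
    define E where "E = (\<lambda>n. norm (coeff (Q n) 0) * exp (R * (norm (coeff (Q n) 1) / norm (coeff (Q n) 0))))"
    define B where "B = (\<lambda>n. (\<Sum>k<M. norm (coeff (P n) k) * R ^ k) + R ^ M * E n)"
    have "convergent E"
    proof (rule convergentI)
      show "E \<longlonglongrightarrow> norm (c 0) * exp (R * (norm (c 1) / norm (c 0)))"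
        unfolding E_def by (intro tendsto_intros limQ) (use M poch[of 0] in \<open>auto simp: c_def\<close>)
    qed
    then have "convergent B"
      unfolding B_def
      by (intro convergent_add convergent_mult convergent_const convergent_sum convergent_norm)
         (use limP in \<open>auto intro: convergentI\<close>)
    then have "Bseq B"
      by (rule convergent_imp_Bseq)
    then obtain K where K: "\<And>n. norm (B n) \<le> K"
      by (auto simp: Bseq_def)
    have E0: "E n \<ge> 0" for n
      by (simp add: E_def)
    have "norm (coeff (P n) k) * R ^ k \<le> B n" for n k
    proof (cases "k < M")
      case True
      then have "norm (coeff (P n) k) * R ^ k \<le> (\<Sum>k<M. norm (coeff (P n) k) * R ^ k)"
        using R by (intro member_le_sum) auto
      also have "\<dots> \<le> B n"
        using R E0 by (simp add: B_def)
      finally show ?thesis .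
    next
      case False
      then obtain j where j: "k = j + M"
        by (metis add.commute le_Suc_ex not_less)
      have "norm (coeff (P n) k) \<le> norm (coeff (Q n) j)"
        unfolding coeffQ j norm_mult using poch[of j]
        by (metis mult_right_mono mult_1 norm_ge_zero)
      then have "norm (coeff (P n) k) * R ^ k \<le> R ^ M * (norm (coeff (Q n) j) * R ^ j)"
        using R unfolding j power_add by (auto simp: mult_ac intro!: mult_left_mono)
      also have "\<dots> \<le> R ^ M * norm (poly (Q n) (of_real R))"
        using R coeff_le_poly_P_plus[OF Q R] by (intro mult_left_mono) auto
      also have "\<dots> \<le> R ^ M * E n"
        unfolding E_def using R norm_poly_P_plus_le[OF Q Q0 R] by (intro mult_left_mono) auto
      also have "\<dots> \<le> B n"
        unfolding B_def using R by (simp add: sum_nonneg)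
      finally show ?thesis .
    qed
    moreover have "B n \<le> K" for n
      using K[of n] by simp
    ultimately show ?thesis
      by (meson order.trans)
  qed
  have boundF: "norm (fps_nth F k) * R ^ k \<le> B" if "\<forall>n k. norm (coeff (P n) k) * R ^ k \<le> B" for R B k
  proof (rule LIMSEQ_le_const2)
    show "(\<lambda>n. norm (coeff (P n) k) * R ^ k) \<longlonglongrightarrow> norm (fps_nth F k) * R ^ k"
      by (intro tendsto_intros limP)
  qed (use that in auto)

  \<comment> \<open>A bound at radius \<open>2 * r\<close> dominates the series at radius
    \<open>r\<close> by a geometric one of ratio \<open>1 / 2\<close>.\<close>
  have conv: "fps_conv_radius F = \<infinity>"
    unfolding fps_conv_radius_def
  proof (rule conv_radius_inftyI'[of 0])
    fix r :: real assume r: "r > 0"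
    obtain B where B: "\<forall>n k. norm (coeff (P n) k) * (2 * r) ^ k \<le> B"
      using bound[of "2 * r"] r by auto
    have "summable (\<lambda>k. fps_nth F k * of_real r ^ k)"
    proof (rule summable_comparison_test'[of "\<lambda>k. B * (1 / 2) ^ k" 0])
      show "summable (\<lambda>k. B * (1 / 2) ^ k)"
        by (intro summable_mult summable_geometric) auto
      show "norm (fps_nth F k * of_real r ^ k) \<le> B * (1 / 2) ^ k" for k
        using boundF[OF B, of k] r by (simp add: norm_mult norm_power power_mult_distrib field_simps)
    qed
    then show "\<exists>z. norm z = r \<and> summable (\<lambda>k. fps_nth F k * z ^ k)"
      using r by (intro exI[of _ "of_real r"]) auto
  qed
  define f where "f = eval_fps F"
  have holf: "f holomorphic_on UNIV"
    unfolding f_def using conv by (intro holomorphic_on_eval_fps) (auto simp: eball_def)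
  have taylor: "taylor f = F"
  proof (rule fps_ext)
    have "f has_fps_expansion F"
      unfolding f_def using conv by (intro eval_fps_has_fps_expansion) auto
    then show "fps_nth (taylor f) k = fps_nth F k" for k
      by (simp add: taylor_def fps_expansion_def fps_nth_fps_expansion)
  qed

  have ul: "uniform_limit K (\<lambda>n. poly (P n)) f sequentially" if K: "compact K" for K
  proof -
    obtain R where R: "R > 0" "\<And>z. z \<in> K \<Longrightarrow> norm z \<le> R"
      using compact_imp_bounded[OF K] by (auto simp: bounded_pos)
    obtain B where B: "\<forall>n k. norm (coeff (P n) k) * (2 * R) ^ k \<le> B"
      using bound[of "2 * R"] R by auto
    \<comment> \<open>On \<open>K\<close>, \<open>a k n\<close> majorises the \<open>k\<close>-th
      term of \<open>poly (P n) z - f z\<close>. It tends to 0 for each \<open>k\<close> under a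
      summable bound, so by Tannery's theorem the sum tends to 0, uniformly in
      \<open>z\<close>.\<close>
    define a where "a = (\<lambda>k n. norm (coeff (P n) k - fps_nth F k) * R ^ k)"
    have a_le: "a k n \<le> 2 * B * (1 / 2) ^ k" for k n
    proof -
      have "a k n \<le> (norm (coeff (P n) k) + norm (fps_nth F k)) * R ^ k"
        unfolding a_def using R by (intro mult_right_mono norm_triangle_ineq4) auto
      also have "\<dots> = (norm (coeff (P n) k) * (2 * R) ^ k + norm (fps_nth F k) * (2 * R) ^ k) * (1 / 2) ^ k"
        by (simp add: power_mult_distrib field_simps)
      also have "\<dots> \<le> (B + B) * (1 / 2) ^ k"
        using B boundF[OF B, of k] by (intro mult_right_mono add_mono) auto
      finally show ?thesis
        by simp
    qed
    have a0: "a k n \<ge> 0" for k n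
      using R by (simp add: a_def)
    have summ: "summable (\<lambda>k. 2 * B * (1 / 2) ^ k)"
      by (intro summable_mult summable_geometric) auto
    have "(\<lambda>n. a k n) \<longlonglongrightarrow> norm (fps_nth F k - fps_nth F k) * R ^ k" for k
      unfolding a_def by (intro tendsto_intros limP)
    then have "(\<lambda>n. suminf (\<lambda>k. a k n)) \<longlonglongrightarrow> suminf (\<lambda>k. 0)"
      using tannerys_theorem[of a "\<lambda>_. 0" sequentially "\<lambda>k. 2 * B * (1 / 2) ^ k"] summ a_le a0
      by (auto intro!: always_eventually)
    then have lim0: "(\<lambda>n. suminf (\<lambda>k. a k n)) \<longlonglongrightarrow> 0"
      by simp
    have suma: "summable (\<lambda>k. a k n)" for n
      by (rule summable_comparison_test'[OF summ, of 0]) (use a_le a0 in auto)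
    have le: "norm (poly (P n) z - f z) \<le> suminf (\<lambda>k. a k n)" if z: "z \<in> K" for n z
    proof -
      have s1: "(\<lambda>k. fps_nth (fps_of_poly (P n)) k * z ^ k) sums poly (P n) z"
        using sums_eval_fps[of z "fps_of_poly (P n)"] by simp
      have s2: "(\<lambda>k. fps_nth F k * z ^ k) sums f z"
        unfolding f_def by (rule sums_eval_fps) (simp add: conv)
      have s: "(\<lambda>k. (coeff (P n) k - fps_nth F k) * z ^ k) sums (poly (P n) z - f z)"
        using sums_diff[OF s1 s2] by (simp add: algebra_simps)
      have "norm ((coeff (P n) k - fps_nth F k) * z ^ k) \<le> a k n" for k
        unfolding a_def norm_mult norm_power using R(2)[OF z]
        by (intro mult_left_mono power_mono) auto
      then have "norm (\<Sum>k. (coeff (P n) k - fps_nth F k) * z ^ k) \<le> suminf (\<lambda>k. a k n)"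
        by (intro norm_suminf_le suma) auto
      then show ?thesis
        using s by (simp add: sums_iff)
    qed
    show ?thesis
    proof (rule uniform_limitI)
      fix e :: real assume "e > 0"
      with lim0 have "eventually (\<lambda>n. suminf (\<lambda>k. a k n) < e) sequentially"
        by (rule order_tendstoD(2))
      then show "\<forall>\<^sub>F n in sequentially. \<forall>z\<in>K. dist (poly (P n) z) (f z) < e"
        by eventually_elim (use le in \<open>auto simp: dist_norm intro: order.strict_trans1\<close>)
    qed
  qed
  \<comment> \<open>\<open>LP\<close> asks for real polynomials; the coefficients of
    \<open>P n\<close> are real, so taking real parts recovers \<open>P n\<close>.\<close>
  have mapP: "map_poly of_real (map_poly Re (P n)) = P n" for n
    using P[of n] by (intro poly_eqI)
      (auto simp: coeff_map_poly P_plus_def complex_nonneg_Reals_iff complex_eq_iff)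
  have "f \<in> LP"
    unfolding LP_def
    by (intro CollectI conjI holf exI[of _ "\<lambda>n. map_poly Re (P n)"], unfold mapP)
       (use P ul in \<open>auto simp: P_plus_def\<close>)
  moreover have "fps_nth F k \<in> \<real>\<^sub>\<ge>\<^sub>0" for k
    by (rule closed_sequentially[OF closed_nonneg_Reals_complex _ limP])
       (use P in \<open>auto simp: P_plus_def\<close>)
  ultimately have "f \<in> LP_plus"
    by (simp add: LP_plus_def taylor)
  then show ?thesis
    using taylor by blast
qed auto

subsection \<open>The kernel polynomial\<close>

lemma sum_in_nonneg_Reals:
  assumes "\<And>x. x \<in> A \<Longrightarrow> f x \<in> \<real>\<^sub>\<ge>\<^sub>0"
  shows "sum f A \<in> \<real>\<^sub>\<ge>\<^sub>0"
  using assms by (induction A rule: infinite_finite_induct) auto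

text \<open>Nonpositive zeros make \<open>p / lead_coeff p\<close> a polynomial with nonnegative
  coefficients, positive at 1. A nonnegative value \<open>p(1)\<close> therefore forces a
  nonnegative leading coefficient.\<close>

lemma P_plusI_value:
  assumes "p \<noteq> 0" and roots: "\<forall>z. poly p z = 0 \<longrightarrow> z \<in> \<real> \<and> Re z \<le> 0"
    and one: "poly p 1 \<in> \<real>\<^sub>\<ge>\<^sub>0"
  shows "p \<in> P_plus"
proof -
  have "\<forall>k. coeff p k / lead_coeff p \<in> \<real>\<^sub>\<ge>\<^sub>0"
    using assms(1,2)
  proof (induction p rule: poly_roots_induct)
    case (const c)
    then show ?case
      by (auto simp: coeff_pCons split: nat.splits)
  next
    case (root a p)
    have a: "- a \<in> \<real>\<^sub>\<ge>\<^sub>0"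
      using root.hyps(1) by (auto simp: complex_nonneg_Reals_iff complex_is_Real_iff)
    have "coeff ([:- a, 1:] * p) k / lead_coeff ([:- a, 1:] * p)
        = - a * (coeff p k / lead_coeff p) + (case k of 0 \<Rightarrow> 0 | Suc j \<Rightarrow> coeff p j / lead_coeff p)" for k
      unfolding lead_coeff_mult
      by (cases k) (auto simp: coeff_pCons diff_divide_distrib)
    moreover have "- a * (coeff p k / lead_coeff p) + (case k of 0 \<Rightarrow> 0 | Suc j \<Rightarrow> coeff p j / lead_coeff p) \<in> \<real>\<^sub>\<ge>\<^sub>0" for k
      using a root.IH by (intro nonneg_Reals_add_I nonneg_Reals_mult_I) (auto split: nat.splits)
    ultimately show ?case
      by metis
  qed
  then have *: "coeff p k / lead_coeff p \<in> \<real>\<^sub>\<ge>\<^sub>0" for k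
    by blast
  define r where "r = poly p 1 / lead_coeff p"
  have "r = (\<Sum>k\<le>degree p. coeff p k / lead_coeff p)"
    by (simp add: r_def poly_altdef sum_divide_distrib)
  also have "\<dots> \<in> \<real>\<^sub>\<ge>\<^sub>0"
    using * by (intro sum_in_nonneg_Reals)
  finally have "r \<in> \<real>\<^sub>\<ge>\<^sub>0" .
  moreover have "r \<noteq> 0"
    using roots assms(1) by (auto simp: r_def)
  moreover have "lead_coeff p = poly p 1 / r"
    using \<open>r \<noteq> 0\<close> by (auto simp: r_def)
  ultimately have "lead_coeff p \<in> \<real>\<^sub>\<ge>\<^sub>0"
    using one by (metis nonneg_Reals_divide_I)
  then have "lead_coeff p * (coeff p k / lead_coeff p) \<in> \<real>\<^sub>\<ge>\<^sub>0" for k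
    using * by (intro nonneg_Reals_mult_I)
  then show ?thesis
    using assms(1) roots by (auto simp: P_plus_def)
qed

text \<open>For \<open>s > 0\<close> the only zero is \<open>- (w / s + s / w)\<close>, where both
  summands in the bracket have positive real part. For \<open>s = 0\<close> the factor is the
  constant \<open>w\<^sup>2\<close>.\<close>

lemma factor_kernel:
  fixes w :: complex and s :: real
  assumes "Re w > 0" "s \<ge> 0"
  defines "q \<equiv> [:w\<^sup>2 + of_real s ^ 2, of_real s * w:]"
  shows "q \<noteq> 0" "degree q = (if s = 0 then 0 else 1)" "poly q y = 0 \<Longrightarrow> Re y < 0"
proof -
  have w: "w \<noteq> 0"
    using assms by auto
  show "q \<noteq> 0" "degree q = (if s = 0 then 0 else 1)"
    using w by (auto simp: q_def)
  assume y: "poly q y = 0"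
  have s: "s > 0"
    using y w assms(2) by (cases "s = 0") (auto simp: q_def)
  have "y = - (w / of_real s + of_real s / w)"
    using y w s by (simp add: q_def field_simps power2_eq_square add_eq_0_iff)
  moreover have "Re (w / of_real s) > 0" "Re (of_real s / w) > 0"
    using assms(1) s w by (auto simp: Re_divide zero_less_divide_iff sum_power2_gt_zero_iff complex_eq_iff)
  ultimately show "Re y < 0"
    by simp
qed

text \<open>
  For \<open>p = \<Prod>\<^sub>i (z + s\<^sub>i)\<close> the witness is
  \<open>K w = \<Prod>\<^sub>i (w\<^sup>2 + s\<^sub>i\<^sup>2 + s\<^sub>i w y)\<close>.
\<close>

lemma kernel_exists:
  assumes "p \<noteq> 0" "\<forall>z. poly p z = 0 \<longrightarrow> z \<in> \<real> \<and> Re z \<le> 0"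
  shows "\<exists>K N. (\<forall>w u. u \<noteq> 0 \<longrightarrow> poly (K w) (u + 1 / u) = poly p (w * u) * poly p (w / u)) \<and>
    (\<forall>w. degree (K w) \<le> degree p) \<and>
    (\<forall>m. (\<lambda>w. coeff (K w) m) holomorphic_on UNIV) \<and>
    (\<forall>w. Re w > 0 \<longrightarrow> K w \<noteq> 0 \<and> degree (K w) = N \<and> (\<forall>y. poly (K w) y = 0 \<longrightarrow> Re y < 0)) \<and>
    (\<forall>m. coeff (K 1) m / lead_coeff p ^ 2 \<in> \<real>\<^sub>\<ge>\<^sub>0)"
    (is "\<exists>K N. ?P p K N")
  using assms
proof (induction p rule: poly_roots_induct)
  case (const c)
  have "?P [:c:] (\<lambda>_. [:c\<^sup>2:]) 0"
    using const by (auto simp: power2_eq_square coeff_pCons intro!: holomorphic_intros split: nat.splits)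
  then show ?case
    by (intro exI)
next
  case (root a p)
  define s where "s = - Re a"
  have s: "s \<ge> 0" "a = - of_real s"
    using root.hyps(1) by (auto simp: s_def complex_is_Real_iff complex_eq_iff)
  obtain K N where K: "?P p K N"
    using root.IH by (elim exE)
  define q :: "complex \<Rightarrow> complex poly" where "q = (\<lambda>w. [:w\<^sup>2 + of_real s ^ 2, of_real s * w:])"
  define K' where "K' = (\<lambda>w. q w * K w)"
  have "?P ([:- a, 1:] * p) K' ((if s = 0 then 0 else 1) + N)"
  proof (intro conjI allI impI)
    fix w u :: complex assume u: "u \<noteq> 0"
    \<comment> \<open>This is \<open>(w u + s) (w / u + s) = w\<^sup>2 + s\<^sup>2 + s w (u + 1 /
      u)\<close>.\<close>
    have "poly (q w) (u + 1 / u) = (w * u - a) * (w / u - a)"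
      using u by (simp add: q_def s(2) field_simps power2_eq_square)
    moreover have "poly (K w) (u + 1 / u) = poly p (w * u) * poly p (w / u)"
      using K u by blast
    moreover have "poly ([:- a, 1:] * p) z = (z - a) * poly p z" for z
      by (simp add: algebra_simps)
    ultimately show "poly (K' w) (u + 1 / u) = poly ([:- a, 1:] * p) (w * u) * poly ([:- a, 1:] * p) (w / u)"
      unfolding K'_def poly_mult[of "q w"] by (simp only: mult_ac)
  next
    fix w
    have "degree (q w) \<le> 1"
      by (simp add: q_def)
    moreover have "degree ([:- a, 1:] * p) = Suc (degree p)"
      using root.hyps by (subst degree_mult_eq) auto
    moreover have "degree (K w) \<le> degree p"
      using K by blast
    ultimately show "degree (K' w) \<le> degree ([:- a, 1:] * p)"
      unfolding K'_def using degree_mult_le[of "q w" "K w"] by linarith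
  next
    fix m
    have *: "(\<lambda>w. coeff (K' w) m) = (\<lambda>w. (w\<^sup>2 + of_real s ^ 2) * coeff (K w) m
        + (case m of 0 \<Rightarrow> 0 | Suc j \<Rightarrow> of_real s * w * coeff (K w) j))"
      by (auto simp: K'_def q_def coeff_pCons split: nat.splits)
    show "(\<lambda>w. coeff (K' w) m) holomorphic_on UNIV"
      unfolding * using K by (cases m) (auto intro!: holomorphic_intros)
  next
    fix w :: complex assume w: "Re w > 0"
    have "q w = [:w\<^sup>2 + of_real s ^ 2, of_real s * w:]"
      by (simp add: q_def)
    note q = factor_kernel[OF w s(1), folded this]
    have Kw: "K w \<noteq> 0" "degree (K w) = N" "\<forall>y. poly (K w) y = 0 \<longrightarrow> Re y < 0"
      using K w by blast+
    show "K' w \<noteq> 0" "degree (K' w) = (if s = 0 then 0 else 1) + N"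
      using q(1,2) Kw(1,2) by (auto simp: K'_def degree_mult_eq)
    show "Re y < 0" if "poly (K' w) y = 0" for y
      using that q(3) Kw(3) by (auto simp: K'_def)
  next
    fix m
    \<comment> \<open>The product starts from the square of the leading coefficient. Dividing by it
      leaves, at \<open>w = 1\<close>, factors with nonnegative coefficients
      \<open>1 + s\<^sup>2\<close> and \<open>s\<close>.\<close>
    have lead: "lead_coeff ([:- a, 1:] * p) = lead_coeff p"
      by (subst lead_coeff_mult) auto
    have IH: "coeff (K 1) m / lead_coeff p ^ 2 \<in> \<real>\<^sub>\<ge>\<^sub>0" for m
      using K by blast
    have "coeff (K' 1) m / lead_coeff p ^ 2 = of_real (1 + s ^ 2) * (coeff (K 1) m / lead_coeff p ^ 2)
        + (case m of 0 \<Rightarrow> 0 | Suc j \<Rightarrow> of_real s * (coeff (K 1) j / lead_coeff p ^ 2))"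
      by (auto simp: K'_def q_def coeff_pCons add_divide_distrib split: nat.splits)
    also have "\<dots> \<in> \<real>\<^sub>\<ge>\<^sub>0"
    proof (intro nonneg_Reals_add_I nonneg_Reals_mult_I IH)
      show "complex_of_real (1 + s\<^sup>2) \<in> \<real>\<^sub>\<ge>\<^sub>0"
        by (subst nonneg_Reals_of_real_iff) simp
      show "(case m of 0 \<Rightarrow> 0 | Suc j \<Rightarrow> of_real s * (coeff (K 1) j / lead_coeff p ^ 2)) \<in> \<real>\<^sub>\<ge>\<^sub>0"
        using s(1) IH by (auto split: nat.splits intro!: nonneg_Reals_mult_I
            simp del: times_divide_eq_right)
    qed
    finally show "coeff (K' 1) m / lead_coeff ([:- a, 1:] * p) ^ 2 \<in> \<real>\<^sub>\<ge>\<^sub>0"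
      unfolding lead .
  qed
  then show ?case
    by (intro exI)
qed

text \<open>This is the coefficient of \<open>u ^ (2 * j)\<close> in \<open>(u + 1 / u) ^ l\<close>,
  after multiplication by \<open>u ^ l\<close>.\<close>

lemma coeff_one_plus_X2_power:
  "coeff ([:1, 0, 1:] ^ l :: complex poly) (l + 2 * j) =
     (if even l then of_nat (l choose (l div 2 + j)) else 0)"
proof -
  have "[:1, 0, 1:] = monom 1 2 + (1 :: complex poly)"
    by (simp add: monom_altdef power2_eq_square one_pCons)
  then have "[:1, 0, 1:] ^ l = (\<Sum>i\<le>l. of_nat (l choose i) * (monom 1 2 :: complex poly) ^ i)"
    by (simp add: binomial_ring)
  also have "\<dots> = (\<Sum>i\<le>l. monom (of_nat (l choose i)) (2 * i))"
    by (intro sum.cong) (auto simp: monom_power of_nat_poly smult_monom mult.commute)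
  finally have "coeff ([:1, 0, 1:] ^ l) (l + 2 * j) =
     (\<Sum>i\<le>l. if 2 * i = l + 2 * j then of_nat (l choose i) else 0 :: complex)"
    by (simp add: coeff_sum)
  also have "\<dots> = (if even l then of_nat (l choose (l div 2 + j)) else 0)"
  proof (cases "even l")
    case True
    then have "(2 * i = l + 2 * j) = (i = l div 2 + j)" for i
      by auto
    then show ?thesis
      using True by (auto simp: sum.delta binomial_eq_0)
  next
    case False
    then have "2 * i \<noteq> l + 2 * j" for i
      by presburger
    then show ?thesis
      using False by simp
  qed
  finally show ?thesis .
qed

text \<open>Both sides are the coefficient of \<open>u ^ (2 * j)\<close> in the hypothesis
  \<open>K\<close>: the left one from expanding powers of \<open>u + 1 / u\<close>, the right one
  from multiplying out \<open>p(w u) p(w / u)\<close>.\<close>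

lemma kernel_coeff_identity:
  fixes K p :: "complex poly"
  assumes deg: "degree K \<le> degree p"
    and K: "\<And>u. u \<noteq> 0 \<Longrightarrow> poly K (u + 1 / u) = poly p (w * u) * poly p (w / u)"
  shows "(\<Sum>l\<le>degree p. coeff K l * (if even l then of_nat (l choose (l div 2 + j)) else 0))
    = (\<Sum>t\<le>degree p. coeff p (t + 2 * j) * coeff p t * (w\<^sup>2) ^ (t + j))"
proof -
  define n where "n = degree p"
  \<comment> \<open>Multiplying by \<open>u ^ n\<close> clears the negative powers, so
    \<open>A\<close> and \<open>B\<close> are polynomials and the wanted coefficient moves to index
    \<open>n + 2 * j\<close>.\<close>
  define A where "A = (\<Sum>l\<le>n. smult (coeff K l) (monom 1 (n - l) * [:1, 0, 1:] ^ l))"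
  define B where "B = (\<Sum>s\<le>n. \<Sum>t\<le>n. monom (coeff p s * coeff p t * w ^ (s + t)) (s + (n - t)))"
  have "poly (A - B) u = 0" if "u \<in> - {0}" for u
  proof -
    have u: "u \<noteq> 0"
      using that by simp
    have "poly A u = (\<Sum>l\<le>n. coeff K l * (u ^ (n - l) * (1 + u\<^sup>2) ^ l))"
      by (simp add: A_def poly_sum poly_monom poly_power power2_eq_square)
    also have "\<dots> = (\<Sum>l\<le>n. u ^ n * (coeff K l * (u + 1 / u) ^ l))"
    proof (intro sum.cong refl)
      fix l assume l: "l \<in> {..n}"
      have "u ^ n = u ^ (n - l) * u ^ l"
        using l by (simp flip: power_add)
      moreover have "u * (u + 1 / u) = 1 + u\<^sup>2"
        using u by (simp add: field_simps power2_eq_square)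
      then have "u ^ l * (u + 1 / u) ^ l = (1 + u\<^sup>2) ^ l"
        by (metis power_mult_distrib)
      ultimately show "coeff K l * (u ^ (n - l) * (1 + u\<^sup>2) ^ l) = u ^ n * (coeff K l * (u + 1 / u) ^ l)"
        by (simp add: mult_ac)
    qed
    also have "\<dots> = u ^ n * poly K (u + 1 / u)"
      using deg by (simp add: poly_eq_sum_atMost[of K n] n_def sum_distrib_left)
    also have "\<dots> = u ^ n * (poly p (w * u) * poly p (w / u))"
      using K[OF u] by simp
    also have "\<dots> = (\<Sum>s\<le>n. \<Sum>t\<le>n. u ^ n * ((coeff p s * (w * u) ^ s) * (coeff p t * (w / u) ^ t)))"
      unfolding poly_altdef n_def[symmetric] sum_product by (simp add: sum_distrib_left)
    also have "\<dots> = poly B u"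
      unfolding B_def poly_sum poly_monom
    proof (intro sum.cong refl)
      fix s t assume t: "t \<in> {..n}"
      have "u ^ n = u ^ (n - t) * u ^ t"
        using t by (simp flip: power_add)
      then show "u ^ n * ((coeff p s * (w * u) ^ s) * (coeff p t * (w / u) ^ t))
         = coeff p s * coeff p t * w ^ (s + t) * u ^ (s + (n - t))"
        using u by (simp add: power_add power_mult_distrib power_divide)
    qed
    finally show ?thesis
      by simp
  qed
  then have "A - B = 0"
    by (rule poly_eq_0_on_open[of "- {0}", rotated 2]) (auto simp: open_Compl set_eq_iff intro: exI[of _ 1])
  then have "coeff A (n + 2 * j) = coeff B (n + 2 * j)"
    by simp
  moreover have "coeff A (n + 2 * j) = (\<Sum>l\<le>n. coeff K l * (if even l then of_nat (l choose (l div 2 + j)) else 0))"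
  proof -
    have "coeff (monom 1 (n - l) * [:1, 0, 1:] ^ l :: complex poly) (n + 2 * j) =
       (if even l then of_nat (l choose (l div 2 + j)) else 0)" if "l \<le> n" for l
    proof -
      have "n + 2 * j - (n - l) = l + 2 * j" "\<not> n + 2 * j < n - l"
        using that by auto
      then show ?thesis
        by (simp only: coeff_monom_mult coeff_one_plus_X2_power if_False mult_1_left)
    qed
    then show ?thesis
      by (simp add: A_def coeff_sum)
  qed
  moreover have "coeff B (n + 2 * j) = (\<Sum>t\<le>n. coeff p (t + 2 * j) * coeff p t * (w\<^sup>2) ^ (t + j))"
  proof -
    have "coeff B (n + 2 * j) =
        (\<Sum>t\<le>n. \<Sum>s\<le>n. if s + (n - t) = n + 2 * j then coeff p s * coeff p t * w ^ (s + t) else 0)"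
      unfolding B_def by (subst sum.swap) (simp add: coeff_sum)
    also have "\<dots> = (\<Sum>t\<le>n. \<Sum>s\<le>n. if s = t + 2 * j then coeff p s * coeff p t * w ^ (s + t) else 0)"
      by (intro sum.cong refl if_cong) auto
    also have "\<dots> = (\<Sum>t\<le>n. coeff p (t + 2 * j) * coeff p t * (w\<^sup>2) ^ (t + j))"
    proof (intro sum.cong refl)
      fix t
      have "w ^ (t + 2 * j + t) = (w\<^sup>2) ^ (t + j)"
        by (simp flip: power_mult add: mult_2 algebra_simps)
      then show "(\<Sum>s\<le>n. if s = t + 2 * j then coeff p s * coeff p t * w ^ (s + t) else 0)
          = coeff p (t + 2 * j) * coeff p t * (w\<^sup>2) ^ (t + j)"
        by (auto simp: sum.delta n_def coeff_eq_0)
    qed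
    finally show ?thesis .
  qed
  ultimately show ?thesis
    by (simp add: n_def)
qed

text \<open>Once the lower coefficients of \<open>p\<close> vanish, coefficient
  \<open>degree q - i\<close> of \<open>p(D) q\<close> is a nonzero multiple of coefficient
  \<open>i\<close> of \<open>p\<close>. Hence vanishing at one \<open>q\<close> passes to all
  polynomials of the same degree.\<close>

lemma diff_op_eq_0D:
  assumes "diff_op p q = 0" "q \<noteq> 0" "i \<le> degree q"
  shows "coeff p i = 0"
  using assms(3)
proof (induction i rule: less_induct)
  case (less i)
  define d where "d = degree q - i"
  have d: "d + i = degree q"
    using less.prems by (simp add: d_def)
  have "pochhammer (Suc d) i > 0"
    by (rule pochhammer_pos) simp
  then have pochhammer_nz: "pochhammer (of_nat (Suc d)) i \<noteq> (0 :: complex)"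
    by (simp only: pochhammer_of_nat of_nat_eq_0_iff)
  define N where "N = max i (degree p)"
  have "0 = coeff (diff_op p q) d"
    using assms(1) by simp
  also have "\<dots> = (\<Sum>j\<le>N. coeff p j * (pochhammer (of_nat (Suc d)) j * coeff q (d + j)))"
    by (subst diff_op_altdef[of p N]) (auto simp: N_def coeff_sum coeff_higher_pderiv)
  also have "\<dots> = (\<Sum>j\<le>N. if j = i then coeff p i * (pochhammer (of_nat (Suc d)) i * lead_coeff q) else 0)"
  proof (intro sum.cong refl)
    fix j
    show "coeff p j * (pochhammer (of_nat (Suc d)) j * coeff q (d + j))
        = (if j = i then coeff p i * (pochhammer (of_nat (Suc d)) i * lead_coeff q) else 0)"
    proof (cases j i rule: linorder_cases)
      case less
      then show ?thesis
        using less.IH[of j] less.prems by simp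
    next
      case greater
      then show ?thesis
        using d by (simp add: coeff_eq_0)
    qed (simp add: d)
  qed
  also have "\<dots> = coeff p i * (pochhammer (of_nat (Suc d)) i * lead_coeff q)"
    by (simp add: sum.delta N_def)
  finally show ?case
    using assms(2) pochhammer_nz by auto
qed

section \<open>Evaluation at 0 of \<open>p(D) q\<close> for symbols that are polynomials in
  \<open>D\<^sup>2\<close>\<close>

lemma poly_diff_op_0:
  assumes "degree q \<le> n"
  shows "poly (diff_op p q) 0 = (\<Sum>l\<le>n. coeff p l * fact l * coeff q l)"
proof -
  have "poly (diff_op p q) 0 = (\<Sum>l\<le>max n (degree p). coeff p l * fact l * coeff q l)"
    by (subst diff_op_altdef[of p "max n (degree p)"])
       (auto simp: poly_0_coeff_0 coeff_sum coeff_higher_pderiv pochhammer_fact[symmetric] mult_ac)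
  also have "\<dots> = (\<Sum>l\<le>n. coeff p l * fact l * coeff q l)"
    using assms by (intro sum.mono_neutral_right) (auto simp: coeff_eq_0)
  finally show ?thesis .
qed

lemma coeff_pcompose_X2:
  "coeff (pcompose g [:0, 0, 1:]) l = (if even l then coeff g (l div 2) else (0 :: complex))"
proof (induction g arbitrary: l)
  case (pCons a g)
  have "[:0, 0, 1:] * r = pCons 0 (pCons 0 r)" for r :: "complex poly"
    by simp
  then have "pcompose (pCons a g) [:0, 0, 1:] = [:a:] + pCons 0 (pCons 0 (pcompose g [:0, 0, 1:]))"
    by (simp add: pcompose_pCons)
  then show ?case
    using pCons.IH by (auto simp: coeff_pCons split: nat.splits)
qed auto

text \<open>For \<open>degree q \<le> n\<close> this is \<open>[F(D\<^sup>2) q](0)\<close>, where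
  \<open>F\<close> has the coefficients \<open>c\<close>. The truncated sum makes sense for any
  \<open>c\<close> and is continuous in its entries.\<close>

definition even_pairing :: "nat \<Rightarrow> (nat \<Rightarrow> complex) \<Rightarrow> complex poly \<Rightarrow> complex" where
  "even_pairing n c q = (\<Sum>l\<le>n. (if even l then fact l * c (l div 2) else 0) * coeff q l)"

lemma even_pairing_eq_diff_op:
  assumes "degree q \<le> n"
  shows "even_pairing n (coeff g) q = poly (diff_op (pcompose g [:0, 0, 1:]) q) 0"
  unfolding poly_diff_op_0[OF assms] even_pairing_def
  by (intro sum.cong) (auto simp: coeff_pcompose_X2)

text \<open>The zeros of \<open>g(z\<^sup>2)\<close> are purely imaginary, so
  \<open>g(D\<^sup>2)\<close> keeps the closed right half-plane free of zeros, and the pairing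
  evaluates at its boundary point 0. The common degree \<open>N\<close> makes the vanishing of
  \<open>g(D\<^sup>2) (K w)\<close> independent of \<open>w\<close>.\<close>

lemma even_pairing_zero_free:
  assumes g: "g \<in> P_plus \<union> {0}"
    and K: "\<And>w. w \<in> S \<Longrightarrow> K w \<noteq> 0 \<and> degree (K w) = N \<and> (\<forall>y. poly (K w) y = 0 \<longrightarrow> Re y < 0)"
    and N: "N \<le> n"
  shows "(\<forall>w\<in>S. even_pairing n (coeff g) (K w) = 0) \<or> (\<forall>w\<in>S. even_pairing n (coeff g) (K w) \<noteq> 0)"
proof (cases "g = 0")
  case False
  define G where "G = pcompose g [:0, 0, 1:]"
  have G0: "G \<noteq> 0"
    using False by (auto simp: G_def pcompose_eq_0_iff)
  have rootsG: "\<forall>z. poly G z = 0 \<longrightarrow> z / \<i> \<in> \<real>"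
  proof (intro allI impI)
    fix z assume "poly G z = 0"
    then have "poly g (z\<^sup>2) = 0"
      by (simp add: G_def poly_pcompose power2_eq_square)
    then have "Im (z\<^sup>2) = 0" "Re (z\<^sup>2) \<le> 0"
      using g False by (auto simp: P_plus_def complex_is_Real_iff)
    then have "Re z * Im z = 0" "(Re z)\<^sup>2 \<le> (Im z)\<^sup>2"
      by (auto simp: Re_power2 Im_power2)
    then have "Re z = 0"
      by auto
    then show "z / \<i> \<in> \<real>"
      by (simp add: complex_is_Real_iff)
  qed
  have ep: "even_pairing n (coeff g) (K w) = poly (diff_op G (K w)) 0" if "w \<in> S" for w
    unfolding G_def using K[OF that] N by (intro even_pairing_eq_diff_op) auto
  \<comment> \<open>Here \<open>\<omega> = \<i>\<close>, and
    \<open>Im (\<i> * (y - z)) = Re (y - z)\<close> is positive for \<open>y\<close> in the closed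
    right half-plane and \<open>z\<close> outside it.\<close>
  have zf: "zero_free {y. Re y \<ge> 0} (diff_op G (K w))" if "w \<in> S" for w
    by (rule zero_free_diff_op[OF _ G0 rootsG]) (use K[OF that] in \<open>auto simp: zero_free_def\<close>)
  have "\<forall>w\<in>S. even_pairing n (coeff g) (K w) = 0" if w0: "w0 \<in> S" "diff_op G (K w0) = 0" for w0
  proof
    fix w assume w: "w \<in> S"
    have "coeff G i = 0" if "i \<le> N" for i
      using diff_op_eq_0D[OF w0(2)] K[OF w0(1)] that by auto
    then show "even_pairing n (coeff g) (K w) = 0"
      unfolding ep[OF w] poly_diff_op_0[of "K w" N, unfolded K[OF w]] using K[OF w] by (subst poly_diff_op_0[of _ N]) auto
  qed
  moreover have "even_pairing n (coeff g) (K w) \<noteq> 0" if "w \<in> S" "diff_op G (K w) \<noteq> 0" for w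
    using zf[OF that(1)] that ep by (auto simp: zero_free_def)
  ultimately show ?thesis
    by blast
next
  case True
  then have "even_pairing n (coeff g) q = 0" for q
    unfolding even_pairing_def by (intro sum.neutral) auto
  then show ?thesis
    by simp
qed

section \<open>Coefficients of \<open>U \<alpha>\<close> on the exponential series and on
  polynomials\<close>

lemma taylor_exp: "taylor exp = Abs_fps (\<lambda>k. 1 / fact k)"
proof (rule fps_ext)
  show "fps_nth (taylor exp) k = fps_nth (Abs_fps (\<lambda>k. 1 / fact k)) k" for k
    using fps_nth_fps_expansion[OF has_fps_expansion_exp1, of k]
    by (simp add: taylor_def fps_expansion_def)
qed

lemma fps_nth_U_exp:
  "fps_nth (U \<alpha> (taylor exp)) m = of_real (\<Sum>j\<le>m. \<alpha> j / (fact (m + j) * fact (m - j)))"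
  by (simp add: U_def taylor_exp mult_ac)

text \<open>The factor \<open>(2 * m)!\<close> turns \<open>1 / ((m + j)! * (m - j)!)\<close> into a
  binomial coefficient. This vanishes for \<open>j > m\<close>, so the sum may run to a bound common
  to all \<open>m\<close>, ready for an interchange of sums.\<close>

lemma fact_mult_U_exp:
  assumes "m \<le> n"
  shows "fact (2 * m) * fps_nth (U \<alpha> (taylor exp)) m = (\<Sum>j\<le>n. of_real (\<alpha> j) * of_nat ((2 * m) choose (m + j)))"
proof -
  have "fact (2 * m) * (\<alpha> j / (fact (m + j) * fact (m - j))) = \<alpha> j * real ((2 * m) choose (m + j))"
    if "j \<le> m" for j
  proof -
    have "2 * m - (m + j) = m - j"
      using that by simp
    then show ?thesis
      using that by (simp add: binomial_fact)
  qed
  then have "fact (2 * m) * (\<Sum>j\<le>m. \<alpha> j / (fact (m + j) * fact (m - j))) = (\<Sum>j\<le>m. \<alpha> j * real ((2 * m) choose (m + j)))"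
    by (simp add: sum_distrib_left)
  also have "\<dots> = (\<Sum>j\<le>n. \<alpha> j * real ((2 * m) choose (m + j)))"
    using assms by (intro sum.mono_neutral_left) (auto simp: binomial_eq_0)
  finally have "complex_of_real (fact (2 * m) * (\<Sum>j\<le>m. \<alpha> j / (fact (m + j) * fact (m - j))))
     = complex_of_real (\<Sum>j\<le>n. \<alpha> j * real ((2 * m) choose (m + j)))"
    by (rule arg_cong)
  then show ?thesis
    by (simp add: fps_nth_U_exp)
qed

lemma U_poly:
  obtains B where "fps_of_poly B = U \<alpha> (fps_of_poly p)" "degree B \<le> degree p"
proof
  define B where "B = (\<Sum>k\<le>degree p. monom (fps_nth (U \<alpha> (fps_of_poly p)) k) k)"
  have "fps_nth (U \<alpha> (fps_of_poly p)) k = 0" if "k > degree p" for k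
    using that by (auto simp: U_def coeff_eq_0 intro!: sum.neutral)
  then show "fps_of_poly B = U \<alpha> (fps_of_poly p)"
    by (auto simp: fps_eq_iff B_def coeff_sum sum.delta)
  show "degree B \<le> degree p"
    by (rule degree_le) (simp add: B_def coeff_sum sum.delta)
qed

text \<open>Summing \<open>kernel_coeff_identity\<close> over \<open>j\<close> with weights
  \<open>\<alpha> j\<close> assembles the coefficients of \<open>U \<alpha> (taylor exp)\<close> on
  one side and those of \<open>U \<alpha> (fps_of_poly p)\<close> on the other.\<close>

lemma poly_U_eq_even_pairing:
  assumes deg: "degree K \<le> degree p"
    and K: "\<And>u. u \<noteq> 0 \<Longrightarrow> poly K (u + 1 / u) = poly p (w * u) * poly p (w / u)"
    and B: "fps_of_poly B = U \<alpha> (fps_of_poly p)" "degree B \<le> degree p"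
  shows "poly B (w\<^sup>2) = even_pairing (degree p) (fps_nth (U \<alpha> (taylor exp))) K"
proof -
  define n where "n = degree p"
  have "even_pairing n (fps_nth (U \<alpha> (taylor exp))) K =
     (\<Sum>l\<le>n. \<Sum>j\<le>n. of_real (\<alpha> j) * (coeff K l * (if even l then of_nat (l choose (l div 2 + j)) else 0)))"
    unfolding even_pairing_def
  proof (intro sum.cong refl)
    fix l assume l: "l \<in> {..n}"
    show "(if even l then fact l * fps_nth (U \<alpha> (taylor exp)) (l div 2) else 0) * coeff K l
       = (\<Sum>j\<le>n. of_real (\<alpha> j) * (coeff K l * (if even l then of_nat (l choose (l div 2 + j)) else 0)))"
    proof (cases "even l")
      case True
      then show ?thesis
        using fact_mult_U_exp[of "l div 2" n \<alpha>] l by (simp add: sum_distrib_left mult_ac)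
    qed auto
  qed
  also have "\<dots> = (\<Sum>j\<le>n. of_real (\<alpha> j) *
      (\<Sum>l\<le>n. coeff K l * (if even l then of_nat (l choose (l div 2 + j)) else 0)))"
    by (subst sum.swap) (simp only: sum_distrib_left)
  also have "\<dots> = (\<Sum>j\<le>n. of_real (\<alpha> j) * (\<Sum>t\<le>n. coeff p (t + 2 * j) * coeff p t * (w\<^sup>2) ^ (t + j)))"
    unfolding n_def
    by (intro sum.cong refl arg_cong2[of _ _ _ _ "(*)"] kernel_coeff_identity deg K)
  also have "\<dots> = (\<Sum>j\<le>n. \<Sum>t\<le>n. of_real (\<alpha> j) * (coeff p (t + 2 * j) * coeff p t * (w\<^sup>2) ^ (t + j)))"
    by (simp only: sum_distrib_left)
  also have "\<dots> = (\<Sum>(j, t)\<in>{..n} \<times> {..n}. of_real (\<alpha> j) * (coeff p (t + 2 * j) * coeff p t * (w\<^sup>2) ^ (t + j)))"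
    by (simp add: sum.cartesian_product)
  \<comment> \<open>If \<open>j + t > n\<close>, then \<open>t + 2 * j\<close> exceeds the degree of
    \<open>p\<close>. Setting \<open>k = j + t\<close> afterwards gives the double sum that defines
    \<open>U\<close>.\<close>
  also have "\<dots> = (\<Sum>(j, t)\<in>{(j, t). j + t \<le> n}. of_real (\<alpha> j) * (coeff p (t + 2 * j) * coeff p t * (w\<^sup>2) ^ (t + j)))"
    by (rule sum.mono_neutral_right) (auto simp: n_def dest!: le_degree)
  also have "\<dots> = (\<Sum>k\<le>n. \<Sum>j\<le>k. of_real (\<alpha> j) * (coeff p (k - j + 2 * j) * coeff p (k - j) * (w\<^sup>2) ^ (k - j + j)))"
    by (rule sum.triangle_reindex_eq)
  also have "\<dots> = (\<Sum>k\<le>n. coeff B k * (w\<^sup>2) ^ k)"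
  proof (intro sum.cong refl)
    fix k
    have "coeff B k = (\<Sum>j\<le>k. of_real (\<alpha> j) * coeff p (k - j) * coeff p (k + j))"
      using B(1) by (metis (no_types, lifting) U_def fps_nth_Abs_fps fps_of_poly_nth sum.cong)
    moreover have "k - j + 2 * j = k + j" "k - j + j = k" if "j \<le> k" for j
      using that by auto
    ultimately show "(\<Sum>j\<le>k. of_real (\<alpha> j) * (coeff p (k - j + 2 * j) * coeff p (k - j) * (w\<^sup>2) ^ (k - j + j)))
       = coeff B k * (w\<^sup>2) ^ k"
      by (auto simp: sum_distrib_right add.commute[of k] intro!: sum.cong)
  qed
  also have "\<dots> = poly B (w\<^sup>2)"
    using B(2) by (simp add: poly_eq_sum_atMost[of B n] n_def)
  finally show ?thesis
    by (simp add: n_def)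
qed

text \<open>A square root with real part 0 would have a nonpositive real square. Every point off the
  nonpositive axis is thus the square of some \<open>w\<close> in the open right half-plane.\<close>

lemma Re_csqrt_pos:
  assumes "z \<notin> \<real>\<^sub>\<le>\<^sub>0"
  shows "Re (csqrt z) > 0"
proof (rule ccontr)
  define r where "r = csqrt z"
  assume "\<not> ?thesis"
  then have "Re r = 0"
    using csqrt_principal[of z] by (auto simp: r_def)
  moreover have "z = r * r"
    using power2_csqrt[of z] by (simp add: r_def power2_eq_square)
  ultimately show False
    using assms by (simp add: complex_nonpos_Reals_iff)
qed

lemma U_P_plus:
  assumes p: "p \<in> P_plus"
    and g: "\<And>k. g k \<in> P_plus \<union> {0}" "\<And>m. (\<lambda>k. coeff (g k) m) \<longlonglongrightarrow> fps_nth (U \<alpha> (taylor exp)) m"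
  shows "U \<alpha> (fps_of_poly p) \<in> fps_of_poly ` P_plus \<union> {0}"
proof -
  define n where "n = degree p"
  define c where "c = fps_nth (U \<alpha> (taylor exp))"
  define S :: "complex set" where "S = {w. Re w > 0}"
  obtain B where B: "fps_of_poly B = U \<alpha> (fps_of_poly p)" "degree B \<le> degree p"
    by (rule U_poly)
  have "\<exists>K N. (\<forall>w u. u \<noteq> 0 \<longrightarrow> poly (K w) (u + 1 / u) = poly p (w * u) * poly p (w / u)) \<and>
    (\<forall>w. degree (K w) \<le> degree p) \<and>
    (\<forall>m. (\<lambda>w. coeff (K w) m) holomorphic_on UNIV) \<and>
    (\<forall>w. Re w > 0 \<longrightarrow> K w \<noteq> 0 \<and> degree (K w) = N \<and> (\<forall>y. poly (K w) y = 0 \<longrightarrow> Re y < 0)) \<and>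
    (\<forall>m. coeff (K 1) m / lead_coeff p ^ 2 \<in> \<real>\<^sub>\<ge>\<^sub>0)"
    by (rule kernel_exists) (use p in \<open>auto simp: P_plus_def\<close>)
  then obtain K N where K:
    "\<And>w u. u \<noteq> 0 \<Longrightarrow> poly (K w) (u + 1 / u) = poly p (w * u) * poly p (w / u)"
    "\<And>w. degree (K w) \<le> n"
    "\<And>m. (\<lambda>w. coeff (K w) m) holomorphic_on UNIV"
    "\<And>w. w \<in> S \<Longrightarrow> K w \<noteq> 0 \<and> degree (K w) = N \<and> (\<forall>y. poly (K w) y = 0 \<longrightarrow> Re y < 0)"
    "\<And>m. coeff (K 1) m / lead_coeff p ^ 2 \<in> \<real>\<^sub>\<ge>\<^sub>0"
    unfolding n_def S_def by blast
  have N: "N \<le> n"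
    using K(2)[of 1] K(4)[of 1] by (auto simp: S_def)
  have B_eq: "poly B (w\<^sup>2) = even_pairing n c (K w)" for w
    unfolding n_def c_def using K(1,2) B by (intro poly_U_eq_even_pairing) (auto simp: n_def)
  \<comment> \<open>Hurwitz' theorem is applied in the variable \<open>w\<close>; the approximants
    \<open>g k\<close> enter only through their convergent coefficients.\<close>
  have "(\<forall>w\<in>S. even_pairing n c (K w) = 0) \<or> (\<forall>w\<in>S. even_pairing n c (K w) \<noteq> 0)"
    unfolding even_pairing_def
  proof (rule zero_free_limit)
    show "open S" "connected S"
      by (auto simp: S_def open_halfspace_Re_gt convex_connected convex_halfspace_Re_gt)
    show "(\<lambda>w. coeff (K w) m) holomorphic_on S" for m
      using K(3) by (rule holomorphic_on_subset) auto
    show "(\<lambda>k. if even l then fact l * coeff (g k) (l div 2) else 0)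
        \<longlonglongrightarrow> (if even l then fact l * c (l div 2) else 0)" for l
      unfolding c_def by (auto intro!: tendsto_intros g(2))
    show "(\<forall>w\<in>S. (\<Sum>l\<le>n. (if even l then fact l * coeff (g k) (l div 2) else 0) * coeff (K w) l) = 0) \<or>
          (\<forall>w\<in>S. (\<Sum>l\<le>n. (if even l then fact l * coeff (g k) (l div 2) else 0) * coeff (K w) l) \<noteq> 0)" for k
      by (rule even_pairing_zero_free[OF g(1) _ N, unfolded even_pairing_def]) (use K(4) in blast)
  qed
  then consider "\<forall>w\<in>S. poly B (w\<^sup>2) = 0" | "\<forall>w\<in>S. poly B (w\<^sup>2) \<noteq> 0"
    unfolding B_eq by blast
  moreover have sqrt: "csqrt z \<in> S" if "z \<in> - \<real>\<^sub>\<le>\<^sub>0" for z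
    using that Re_csqrt_pos by (simp add: S_def)
  ultimately show ?thesis
  proof cases
    case 1
    have "poly B z = 0" if "z \<in> - \<real>\<^sub>\<le>\<^sub>0" for z
      using 1 sqrt[OF that] power2_csqrt[of z] by metis
    then have "B = 0"
      by (rule poly_eq_0_on_open[of "- \<real>\<^sub>\<le>\<^sub>0", rotated 2]) (auto simp: open_Compl set_eq_iff intro: exI[of _ 1])
    then show ?thesis
      using B(1) by auto
  next
    case 2
    have roots: "\<forall>z. poly B z = 0 \<longrightarrow> z \<in> \<real> \<and> Re z \<le> 0"
    proof (intro allI impI)
      fix z assume z: "poly B z = 0"
      have "z \<in> \<real>\<^sub>\<le>\<^sub>0"
        using 2 sqrt[of z] power2_csqrt[of z] z by (metis ComplI)
      then show "z \<in> \<real> \<and> Re z \<le> 0"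
        by (auto simp: complex_nonpos_Reals_iff complex_is_Real_iff)
    qed
    have "1 \<in> S"
      by (simp add: S_def)
    then have "B \<noteq> 0"
      using 2 by force
    \<comment> \<open>The numbers \<open>c m\<close> and the coefficients of \<open>K 1\<close> are
      nonnegative, so \<open>w = 1\<close> gives a nonnegative value, which settles the sign of
      \<open>B\<close>.\<close>
    moreover have "poly B 1 \<in> \<real>\<^sub>\<ge>\<^sub>0"
    proof -
      have c: "c m \<in> \<real>\<^sub>\<ge>\<^sub>0" for m
        unfolding c_def
        by (rule closed_sequentially[OF closed_nonneg_Reals_complex _ g(2)])
           (use g(1) in \<open>force simp: P_plus_def\<close>)
      have lead: "lead_coeff p \<in> \<real>\<^sub>\<ge>\<^sub>0" "lead_coeff p \<noteq> 0"
        using p by (auto simp: P_plus_def)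
      have "coeff (K 1) l = lead_coeff p ^ 2 * (coeff (K 1) l / lead_coeff p ^ 2)" for l
        using lead by simp
      then have K1: "coeff (K 1) l \<in> \<real>\<^sub>\<ge>\<^sub>0" for l
        using K(5) lead(1) by (metis nonneg_Reals_mult_I nonneg_Reals_pow_I)
      have fact_nonneg: "(fact l :: complex) \<in> \<real>\<^sub>\<ge>\<^sub>0" for l
        by (metis nonneg_Reals_of_nat_I of_nat_fact)
      have "poly B 1 = even_pairing n c (K 1)"
        using B_eq[of 1] by simp
      also have "\<dots> \<in> \<real>\<^sub>\<ge>\<^sub>0"
        unfolding even_pairing_def
        by (intro sum_in_nonneg_Reals) (auto intro!: nonneg_Reals_mult_I c K1 fact_nonneg)
      finally show ?thesis .
    qed
    ultimately have "B \<in> P_plus"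
      using roots by (intro P_plusI_value)
    then show ?thesis
      using B(1) by force
  qed
qed

subsection \<open>The equivalences\<close>

lemma LP_plus_approx:
  assumes "F \<in> taylor ` LP_plus \<union> {0}"
  obtains g where "\<And>k. g k \<in> P_plus \<union> {0}" "\<And>m. (\<lambda>k. coeff (g k) m) \<longlonglongrightarrow> fps_nth F m"
proof (cases "F = 0")
  case True
  then show ?thesis
    by (intro that[of "\<lambda>_. 0"]) auto
next
  case False
  then obtain f where f: "f \<in> LP_plus" "F = taylor f"
    using assms by auto
  show ?thesis
  proof (rule that)
    show "jensen F (Suc k) \<in> P_plus \<union> {0}" for k
      unfolding f(2) by (rule jensen_in_P_plus[OF f(1)]) simp
    show "(\<lambda>k. coeff (jensen F (Suc k)) m) \<longlonglongrightarrow> fps_nth F m" for m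
      by (rule LIMSEQ_Suc[OF coeff_jensen_tendsto])
  qed
qed

lemma U_tendsto:
  assumes "\<And>m. (\<lambda>n. fps_nth (F n) m) \<longlonglongrightarrow> fps_nth G m"
  shows "(\<lambda>n. fps_nth (U \<alpha> (F n)) m) \<longlonglongrightarrow> fps_nth (U \<alpha> G) m"
  unfolding U_def fps_nth_Abs_fps by (intro tendsto_intros assms)

text \<open>Each coefficient of \<open>U \<alpha> F\<close> is a polynomial in finitely many
  coefficients of \<open>F\<close>, so \<open>U \<alpha>\<close> commutes with coefficientwise
  limits of the approximating polynomials.\<close>

lemma U_LP_plus:
  assumes U: "U \<alpha> ` fps_of_poly ` P_plus \<subseteq> fps_of_poly ` P_plus \<union> {0}"
    and F: "F \<in> taylor ` LP_plus \<union> {0}"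
  shows "U \<alpha> F \<in> taylor ` LP_plus \<union> {0}"
proof -
  obtain g where g: "\<And>k. g k \<in> P_plus \<union> {0}" "\<And>m. (\<lambda>k. coeff (g k) m) \<longlonglongrightarrow> fps_nth F m"
    by (rule LP_plus_approx[OF F]) blast
  have "\<exists>q \<in> P_plus \<union> {0}. U \<alpha> (fps_of_poly (g k)) = fps_of_poly q" for k
  proof (cases "g k = 0")
    case True
    then show ?thesis
      by (intro bexI[of _ 0]) (auto simp: U_def fps_eq_iff)
  next
    case False
    then have "U \<alpha> (fps_of_poly (g k)) \<in> fps_of_poly ` P_plus \<union> {0}"
      using U g(1)[of k] by auto
    then show ?thesis
      by (metis UnE UnI1 UnI2 fps_of_poly_0 imageE singletonD singletonI)
  qed
  then obtain q where q: "\<And>k. q k \<in> P_plus \<union> {0}" "\<And>k. U \<alpha> (fps_of_poly (g k)) = fps_of_poly (q k)"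
    by metis
  have "(\<lambda>k. fps_nth (U \<alpha> (fps_of_poly (g k))) m) \<longlonglongrightarrow> fps_nth (U \<alpha> F) m" for m
    by (rule U_tendsto) (use g(2) in simp)
  then show ?thesis
    by (intro P_plus_tendsto_LP_plus[of q]) (use q in auto)
qed

section \<open>The exponential function as the limit of \<open>(1 + z / n) ^ n\<close>\<close>

lemma jensen_exp:
  assumes "n > 0"
  shows "jensen (taylor exp) n = [:1, 1 / of_nat n:] ^ n"
proof (rule poly_eqI)
  fix k
  have "[:1, 1 / of_nat n:] = monom (1 / of_nat n) 1 + (1 :: complex poly)"
    by (simp add: monom_altdef one_pCons)
  then have "[:1, 1 / of_nat n:] ^ n = (\<Sum>i\<le>n. of_nat (n choose i) * (monom (1 / of_nat n) 1 :: complex poly) ^ i)"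
    by (simp add: binomial_ring)
  also have "\<dots> = (\<Sum>i\<le>n. monom (of_nat (n choose i) / of_nat n ^ i) i)"
    by (intro sum.cong) (auto simp: monom_power of_nat_poly smult_monom power_divide)
  finally show "coeff (jensen (taylor exp) n) k = coeff ([:1, 1 / of_nat n:] ^ n) k"
    by (simp add: coeff_jensen coeff_sum sum.delta taylor_exp)
qed

lemma taylor_exp_in_LP_plus: "taylor exp \<in> taylor ` LP_plus"
proof -
  have "jensen (taylor exp) (Suc n) \<in> P_plus" for n
  proof (rule P_plusI)
    show "jensen (taylor exp) (Suc n) \<noteq> 0"
      by (simp add: jensen_exp del: power_Suc of_nat_Suc)
    show "coeff (jensen (taylor exp) (Suc n)) k \<in> \<real>\<^sub>\<ge>\<^sub>0" for k
    proof -
      have "coeff (jensen (taylor exp) (Suc n)) k = of_nat (Suc n choose k) / of_nat (Suc n) ^ k"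
        by (simp add: coeff_jensen taylor_exp)
      also have "\<dots> \<in> \<real>\<^sub>\<ge>\<^sub>0"
        by (intro nonneg_Reals_divide_I nonneg_Reals_pow_I nonneg_Reals_of_nat_I)
      finally show ?thesis .
    qed
  next
    fix z assume "poly (jensen (taylor exp) (Suc n)) z = 0"
    then have "1 + z / of_nat (Suc n) = 0"
      by (simp add: jensen_exp poly_power del: power_Suc of_nat_Suc)
    then have "z = - of_nat (Suc n)"
      by (simp add: field_simps add_eq_0_iff del: of_nat_Suc)
    then show "z \<in> \<real>"
      by simp
  qed
  then have "taylor exp \<in> taylor ` LP_plus \<union> {0}"
    by (intro P_plus_tendsto_LP_plus[of "\<lambda>n. jensen (taylor exp) (Suc n)"])
       (auto intro: LIMSEQ_Suc[OF coeff_jensen_tendsto])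
  moreover have "taylor exp \<noteq> 0"
    by (auto simp: taylor_exp fps_eq_iff)
  ultimately show ?thesis
    by auto
qed

theorem theorem5p7:
  fixes \<alpha> :: "nat \<Rightarrow> real"
  shows "(U \<alpha> ` fps_of_poly ` P_plus \<subseteq> fps_of_poly ` P_plus \<union> {0}
           \<longleftrightarrow> U \<alpha> (taylor exp) \<in> taylor ` LP_plus \<union> {0}) \<and>
         (U \<alpha> (taylor exp) \<in> taylor ` LP_plus \<union> {0}
           \<longleftrightarrow> Abs_fps (\<lambda>k. of_real (\<Sum>j\<le>k. \<alpha> j / (fact (k + j) * fact (k - j))))
                 \<in> taylor ` LP_plus \<union> {0}) \<and>
         (U \<alpha> (taylor exp) \<in> taylor ` LP_plus \<union> {0}
           \<longleftrightarrow> U \<alpha> ` taylor ` LP_plus \<subseteq> taylor ` LP_plus \<union> {0})"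
proof -
  \<comment> \<open>Condition (i) yields (iii) in general and (ii) at the exponential;
    \<open>exp_imp_poly\<close> leads from (ii) back to (i).\<close>
  have poly_imp_LP: "U \<alpha> F \<in> taylor ` LP_plus \<union> {0}"
    if "U \<alpha> ` fps_of_poly ` P_plus \<subseteq> fps_of_poly ` P_plus \<union> {0}" "F \<in> taylor ` LP_plus" for F
    using U_LP_plus[OF that(1)] that(2) by blast
  have exp_imp_poly: "U \<alpha> ` fps_of_poly ` P_plus \<subseteq> fps_of_poly ` P_plus \<union> {0}"
    if exp: "U \<alpha> (taylor exp) \<in> taylor ` LP_plus \<union> {0}"
  proof -
    obtain g where "\<And>k. g k \<in> P_plus \<union> {0}"
        "\<And>m. (\<lambda>k. coeff (g k) m) \<longlonglongrightarrow> fps_nth (U \<alpha> (taylor exp)) m"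
      by (rule LP_plus_approx[OF exp]) blast
    then have "U \<alpha> (fps_of_poly p) \<in> fps_of_poly ` P_plus \<union> {0}" if "p \<in> P_plus" for p
      by (rule U_P_plus[OF that])
    then show ?thesis
      by blast
  qed
  have U_exp: "Abs_fps (\<lambda>k. of_real (\<Sum>j\<le>k. \<alpha> j / (fact (k + j) * fact (k - j)))) = U \<alpha> (taylor exp)"
    by (rule fps_ext) (simp add: fps_nth_U_exp)
  show ?thesis
    unfolding U_exp
  proof (intro conjI iffI)
    show "U \<alpha> ` taylor ` LP_plus \<subseteq> taylor ` LP_plus \<union> {0}"
      if "U \<alpha> (taylor exp) \<in> taylor ` LP_plus \<union> {0}"
      using poly_imp_LP[OF exp_imp_poly[OF that]] by blast
    show "U \<alpha> (taylor exp) \<in> taylor ` LP_plus \<union> {0}"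
      if "U \<alpha> ` taylor ` LP_plus \<subseteq> taylor ` LP_plus \<union> {0}"
      using that taylor_exp_in_LP_plus by blast
    show "U \<alpha> (taylor exp) \<in> taylor ` LP_plus \<union> {0}"
      if "U \<alpha> ` fps_of_poly ` P_plus \<subseteq> fps_of_poly ` P_plus \<union> {0}"
      using that taylor_exp_in_LP_plus by (rule poly_imp_LP)
    show "U \<alpha> ` fps_of_poly ` P_plus \<subseteq> fps_of_poly ` P_plus \<union> {0}"
      if "U \<alpha> (taylor exp) \<in> taylor ` LP_plus \<union> {0}"
      using that by (rule exp_imp_poly)
  qed
qed

end
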